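(* Let $\Gamma,\Delta$ be finite sets of closed guarded RLL expressions over a finite alphabet $\mathcal{A}$. Then there is a $\mathsf{CRLL}_{\mathcal L}$-proof of the sequent $\Gamma\rightarrow\Delta$ if and only if $\bigcap_{e\in\Gamma}\mathcal L(e)\subseteq\bigcup_{f\in\Delta}\mathcal L(f)$, where an empty intersection is $\mathcal{A}^\omega$ and an empty union is $\emptyset$.
   Context: Fix a finite alphabet $\mathcal{A}$ and a countable set of variables. RLL expressions are generated by $e,f::= X\mid ae\mid 0\mid e+f\mid \mu X e\mid \top\mid e\cap f\mid \nu X e$ ($X$ a variable, $a\in\mathcal{A}$), with $\mu,\nu$ binding $X$; closed means no free variables. $e(X)$ denotes an expression with distinguished free variable $X$ and $e(g)$ the substitution of $g$ for $X$. A closed expression is guarded if every occurrence of a variable $X$ lies inside a subexpression of the form $af$ which is itself within the scope of the binder of that occurrence (so that the occurrence is free in $af$). A $\mu$-formula is one of the form $\mu Xe$, a $\nu$-formula one of form $\nu Xe$; $\sqsubseteq$ is the subformula relation. Language semantics $\mathcal L$ (closed expressions, where subsets $A\subseteq\mathcal{A}^\omega$ may be used as constants with $\mathcal L(A)=A$): $\mathcal L(0)=\emptyset$, $\mathcal L(\top)=\mathcal{A}^\omega$, $\mathcal L(ae)=\{aw:w\in\mathcal L(e)\}$, $\mathcal L(e+f)=\mathcal L(e)\cup\mathcal L(f)$, $\mathcal L(e\cap f)=\mathcal L(e)\cap\mathcal L(f)$, $\mathcal L(\mu Xe(X))=\bigcap\{A\subseteq\mathcal{A}^\omega:\mathcal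 L(e(A))\subseteq A\}$, $\mathcal L(\nu Xe(X))=\bigcup\{A\subseteq\mathcal{A}^\omega:A\subseteq\mathcal L(e(A))\}$. Sequents: $\Gamma\rightarrow\Delta$ with $\Gamma,\Delta$ finite sets of closed expressions; $\Gamma,e$ means $\Gamma\cup\{e\}$ and $a\Gamma=\{ae:e\in\Gamma\}$. The rules of the system $\mathsf L\widehat{\mathsf{RLL}}_{\mathcal L}$ (premisses $\Rightarrow$ conclusion) are: Letter rules: ($\mathsf p$-l) axiom $ae,bf\rightarrow$ (nothing else on either side) for $a\neq b$; ($\mathsf h_a$) from $\Gamma\rightarrow\Delta$ infer $a\Gamma\rightarrow a\Delta$, provided $\Gamma\neq\emptyset$; ($\mathsf p$-r) from the premisses $\rightarrow\Gamma_a$, one for each $a\in\mathcal{A}$, infer $\rightarrow\bigcup_{a\in\mathcal{A}}a\Gamma_a$. Structural: ($\mathsf w$-l) from $\Gamma\rightarrow\Delta$ infer $\Gamma,e\rightarrow\Delta$; ($\mathsf w$-r) from $\Gamma\rightarrow\Delta$ infer $\Gamma\rightarrow\Delta,e$. Left logical: ($0$-l) axiom $\Gamma,0\rightarrow\Delta$; ($\top$-l) from $\Gamma\rightarrow\Delta$ infer $\Gamma,\top\rightarrow\Delta$; ($+$-l) from $\Gamma,e\rightarrow\Delta$ and $\Gamma,f\rightarrow\Delta$ infer $\Gamma,e+f\rightarrow\Delta$; ($\cap$-l) from $\Gamma,e,f\rightarrow\Delta$ infer $\Gamma,e\cap f\rightarrow\Delta$; ($\mu$-l), ($\nu$-l)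 from $\Gamma,e(\sigma Xe(X))\rightarrow\Delta$ infer $\Gamma,\sigma Xe(X)\rightarrow\Delta$ for $\sigma\in\{\mu,\nu\}$. Right logical: ($0$-r) from $\Gamma\rightarrow\Delta$ infer $\Gamma\rightarrow\Delta,0$; ($\top$-r) axiom $\Gamma\rightarrow\Delta,\top$; ($+$-r) from $\Gamma\rightarrow\Delta,e,f$ infer $\Gamma\rightarrow\Delta,e+f$; ($\cap$-r) from $\Gamma\rightarrow\Delta,e$ and $\Gamma\rightarrow\Delta,f$ infer $\Gamma\rightarrow\Delta,e\cap f$; ($\mu$-r), ($\nu$-r) from $\Gamma\rightarrow\Delta,e(\sigma Xe(X))$ infer $\Gamma\rightarrow\Delta,\sigma Xe(X)$. In structural and logical steps the distinguished formula of the conclusion is principal and the distinguished formulas of premisses are auxiliary. A preproof is a possibly infinite tree of sequents in which each node together with its children is an instance of a rule (node = conclusion, children = premisses); it is regular if it has only finitely many distinct subtrees. Immediate ancestry: a formula $e'$ in the LHS/RHS of a premiss is an immediate ancestor of a formula $e$ on the same side of the conclusion if: the step is structural or logical with $e$ principal and $e'$ auxiliary; or the step is $\mathsf h_a$ and $e=ae'$; or the step is $\mathsf p$-r, $e'$ is in the $a$-premiss and $e=ae'$; or $e=e'$. For a branch $B$, a trace is a maximal path along immediate ancestry restricted to $B$ (one formula per sequent, moving upward); it stays on one side (LHS or RHS). An infinite trace is progressing if it is infinitely often principal and the $\sqsubseteq$-smallest formula at which it is infinitely often principal is a $\mu$-formula (for an LHS trace) or a $\nu$-formula (for an RHS trace).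 A preproof is progressing if every infinite branch has a progressing trace. A $\mathsf{CRLL}_{\mathcal L}$-proof is a regular progressing preproof.
   Formalization: The ancestry clause "e = e'" is applied only to structural and logical steps, not to letter steps, and a trace counts as principal at a step only if it passes from the principal formula to an auxiliary one; read literally, both definitions make soundness fail. *)

theory Defs
  imports Main "HOL-Library.Stream" "HOL-Library.Infinite_Set"
begin

section \<open>RLL expressions\<close>

datatype 'a exp =
    Var nat
  | Act 'a "'a exp"
  | Zero
  | Plus "'a exp" "'a exp"
  | Mu nat "'a exp"
  | Top
  | Inter "'a exp" "'a exp"
  | Nu nat "'a exp"

primrec fv :: "'a exp \<Rightarrow> nat set" where
  "fv (Var X) = {X}"
| "fv (Act a e) = fv e"
| "fv Zero = {}"
| "fv (Plus e f) = fv e \<union> fv f"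
| "fv (Mu X e) = fv e - {X}"
| "fv Top = {}"
| "fv (Inter e f) = fv e \<union> fv f"
| "fv (Nu X e) = fv e - {X}"

definition closed_exp :: "'a exp \<Rightarrow> bool" where
  "closed_exp e \<longleftrightarrow> fv e = {}"

text \<open>Substitution of \<open>g\<close> for the free occurrences of \<open>X\<close>. No renaming of bound variables is
  performed: it is only ever applied to closed \<open>g\<close>, for which no capture can occur.\<close>

primrec subst :: "nat \<Rightarrow> 'a exp \<Rightarrow> 'a exp \<Rightarrow> 'a exp" where
  "subst X g (Var Y) = (if Y = X then g else Var Y)"
| "subst X g (Act a e) = Act a (subst X g e)"
| "subst X g Zero = Zero"
| "subst X g (Plus e f) = Plus (subst X g e) (subst X g f)"
| "subst X g (Mu Y e) = (if Y = X then Mu Y e else Mu Y (subst X g e))"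
| "subst X g Top = Top"
| "subst X g (Inter e f) = Inter (subst X g e) (subst X g f)"
| "subst X g (Nu Y e) = (if Y = X then Nu Y e else Nu Y (subst X g e))"

text \<open>The variables having a free occurrence that is not inside any subexpression \<open>Act a f\<close>.\<close>

primrec unguarded_vars :: "'a exp \<Rightarrow> nat set" where
  "unguarded_vars (Var X) = {X}"
| "unguarded_vars (Act a e) = {}"
| "unguarded_vars Zero = {}"
| "unguarded_vars (Plus e f) = unguarded_vars e \<union> unguarded_vars f"
| "unguarded_vars (Mu X e) = unguarded_vars e - {X}"
| "unguarded_vars Top = {}"
| "unguarded_vars (Inter e f) = unguarded_vars e \<union> unguarded_vars f"
| "unguarded_vars (Nu X e) = unguarded_vars e - {X}"

text \<open>Every occurrence of a variable bound by \<open>Mu X e\<close> or \<open>Nu X e\<close> lies inside some \<open>Act a f\<close>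
  within the body \<open>e\<close>, and is free in that \<open>Act a f\<close>.\<close>

primrec guarded :: "'a exp \<Rightarrow> bool" where
  "guarded (Var X) = True"
| "guarded (Act a e) = guarded e"
| "guarded Zero = True"
| "guarded (Plus e f) = (guarded e \<and> guarded f)"
| "guarded (Mu X e) = (X \<notin> unguarded_vars e \<and> guarded e)"
| "guarded Top = True"
| "guarded (Inter e f) = (guarded e \<and> guarded f)"
| "guarded (Nu X e) = (X \<notin> unguarded_vars e \<and> guarded e)"

primrec subexps :: "'a exp \<Rightarrow> 'a exp set" where
  "subexps (Var X) = {Var X}"
| "subexps (Act a e) = insert (Act a e) (subexps e)"
| "subexps Zero = {Zero}"
| "subexps (Plus e f) = insert (Plus e f) (subexps e \<union> subexps f)"
| "subexps (Mu X e) = insert (Mu X e) (subexps e)"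
| "subexps Top = {Top}"
| "subexps (Inter e f) = insert (Inter e f) (subexps e \<union> subexps f)"
| "subexps (Nu X e) = insert (Nu X e) (subexps e)"

definition subformula :: "'a exp \<Rightarrow> 'a exp \<Rightarrow> bool"  (infix "\<sqsubseteq>" 50) where
  "e \<sqsubseteq> f \<longleftrightarrow> e \<in> subexps f"

section \<open>Language semantics\<close>

text \<open>The use of a language \<open>A\<close> as a constant in place of \<open>X\<close> is rendered by
  assigning \<open>A\<close> to \<open>X\<close> in the environment.\<close>

primrec sem :: "(nat \<Rightarrow> 'a stream set) \<Rightarrow> 'a exp \<Rightarrow> 'a stream set" where
  "sem \<rho> (Var X) = \<rho> X"
| "sem \<rho> (Act a e) = (\<lambda>w. a ## w) ` sem \<rho> e"
| "sem \<rho> Zero = {}"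
| "sem \<rho> (Plus e f) = sem \<rho> e \<union> sem \<rho> f"
| "sem \<rho> (Mu X e) = \<Inter>{A. sem (\<rho>(X := A)) e \<subseteq> A}"
| "sem \<rho> Top = UNIV"
| "sem \<rho> (Inter e f) = sem \<rho> e \<inter> sem \<rho> f"
| "sem \<rho> (Nu X e) = \<Union>{A. A \<subseteq> sem (\<rho>(X := A)) e}"

definition lang :: "'a exp \<Rightarrow> 'a stream set" where
  "lang e = sem (\<lambda>_. {}) e"

lemma sem_cong: "(\<And>X. X \<in> fv e \<Longrightarrow> \<rho> X = \<rho>' X) \<Longrightarrow> sem \<rho> e = sem \<rho>' e"
proof (induction e arbitrary: \<rho> \<rho>')
  case (Mu X e)
  have "sem (\<rho>(X := A)) e = sem (\<rho>'(X := A)) e" for A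
    by (rule Mu.IH) (use Mu.prems in auto)
  then show ?case by simp
next
  case (Nu X e)
  have "sem (\<rho>(X := A)) e = sem (\<rho>'(X := A)) e" for A
    by (rule Nu.IH) (use Nu.prems in auto)
  then show ?case by simp
next
  case (Act a e)
  have "sem \<rho> e = sem \<rho>' e"
    by (rule Act.IH) (use Act.prems in auto)
  then show ?case by simp
next
  case (Plus e f)
  have "sem \<rho> e = sem \<rho>' e" "sem \<rho> f = sem \<rho>' f"
    by (rule Plus.IH; use Plus.prems in auto)+
  then show ?case by simp
next
  case (Inter e f)
  have "sem \<rho> e = sem \<rho>' e" "sem \<rho> f = sem \<rho>' f"
    by (rule Inter.IH; use Inter.prems in auto)+
  then show ?case by simp
qed auto

lemma sem_closed: "closed_exp e \<Longrightarrow> sem \<rho> e = lang e"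
  unfolding lang_def closed_exp_def by (rule sem_cong) auto

lemma sem_subst: "closed_exp g \<Longrightarrow> sem \<rho> (subst X g e) = sem (\<rho>(X := lang g)) e"
  by (induction e arbitrary: \<rho>) (auto simp: sem_closed fun_upd_twist)

section \<open>Sequents and inference steps\<close>

type_synonym 'a sequent = "'a exp set \<times> 'a exp set"

definition is_sequent :: "'a sequent \<Rightarrow> bool" where
  "is_sequent S \<longleftrightarrow> finite (fst S) \<and> finite (snd S) \<and> (\<forall>e \<in> fst S \<union> snd S. closed_exp e)"

datatype side = LHS | RHS

primrec formulas :: "side \<Rightarrow> 'a sequent \<Rightarrow> 'a exp set" where
  "formulas LHS S = fst S"
| "formulas RHS S = snd S"

text \<open>An inference step is recorded together with the instantiation of its schema. This matters
  because contexts are sets: the conclusion and premisses alone do not determine which formula is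
  principal. In the order of the arguments, a principal formula stands where it is written in the
  sequent; e.g. \<open>Plus_L \<Gamma> e f \<Delta>\<close> has conclusion \<open>\<Gamma>, e + f \<rightarrow> \<Delta>\<close>.\<close>

datatype 'a inference =
    P_L 'a "'a exp" 'a "'a exp"
  | H 'a "'a exp set" "'a exp set"
  | P_R "'a \<Rightarrow> 'a exp set"
  | W_L "'a exp set" "'a exp" "'a exp set"
  | W_R "'a exp set" "'a exp set" "'a exp"
  | Zero_L "'a exp set" "'a exp set"
  | Top_L "'a exp set" "'a exp set"
  | Plus_L "'a exp set" "'a exp" "'a exp" "'a exp set"
  | Inter_L "'a exp set" "'a exp" "'a exp" "'a exp set"
  | Mu_L "'a exp set" nat "'a exp" "'a exp set"
  | Nu_L "'a exp set" nat "'a exp" "'a exp set"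
  | Zero_R "'a exp set" "'a exp set"
  | Top_R "'a exp set" "'a exp set"
  | Plus_R "'a exp set" "'a exp set" "'a exp" "'a exp"
  | Inter_R "'a exp set" "'a exp set" "'a exp" "'a exp"
  | Mu_R "'a exp set" "'a exp set" nat "'a exp"
  | Nu_R "'a exp set" "'a exp set" nat "'a exp"

text \<open>Positions of premisses: \<open>At a\<close> is the \<open>a\<close>-premiss of \<open>P_R\<close>; unary steps use \<open>Fst\<close>.\<close>

datatype 'a pos = Fst | Snd | At 'a

primrec side_condition :: "'a inference \<Rightarrow> bool" where
  "side_condition (P_L a e b f) = (a \<noteq> b)"
| "side_condition (H a \<Gamma> \<Delta>) = (\<Gamma> \<noteq> {})"
| "side_condition (P_R G) = True"
| "side_condition (W_L \<Gamma> e \<Delta>) = True"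
| "side_condition (W_R \<Gamma> \<Delta> e) = True"
| "side_condition (Zero_L \<Gamma> \<Delta>) = True"
| "side_condition (Top_L \<Gamma> \<Delta>) = True"
| "side_condition (Plus_L \<Gamma> e f \<Delta>) = True"
| "side_condition (Inter_L \<Gamma> e f \<Delta>) = True"
| "side_condition (Mu_L \<Gamma> X e \<Delta>) = True"
| "side_condition (Nu_L \<Gamma> X e \<Delta>) = True"
| "side_condition (Zero_R \<Gamma> \<Delta>) = True"
| "side_condition (Top_R \<Gamma> \<Delta>) = True"
| "side_condition (Plus_R \<Gamma> \<Delta> e f) = True"
| "side_condition (Inter_R \<Gamma> \<Delta> e f) = True"
| "side_condition (Mu_R \<Gamma> \<Delta> X e) = True"
| "side_condition (Nu_R \<Gamma> \<Delta> X e) = True"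

primrec conclusion :: "'a inference \<Rightarrow> 'a sequent" where
  "conclusion (P_L a e b f) = ({Act a e, Act b f}, {})"
| "conclusion (H a \<Gamma> \<Delta>) = (Act a ` \<Gamma>, Act a ` \<Delta>)"
| "conclusion (P_R G) = ({}, \<Union>a. Act a ` G a)"
| "conclusion (W_L \<Gamma> e \<Delta>) = (\<Gamma> \<union> {e}, \<Delta>)"
| "conclusion (W_R \<Gamma> \<Delta> e) = (\<Gamma>, \<Delta> \<union> {e})"
| "conclusion (Zero_L \<Gamma> \<Delta>) = (\<Gamma> \<union> {Zero}, \<Delta>)"
| "conclusion (Top_L \<Gamma> \<Delta>) = (\<Gamma> \<union> {Top}, \<Delta>)"
| "conclusion (Plus_L \<Gamma> e f \<Delta>) = (\<Gamma> \<union> {Plus e f}, \<Delta>)"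
| "conclusion (Inter_L \<Gamma> e f \<Delta>) = (\<Gamma> \<union> {Inter e f}, \<Delta>)"
| "conclusion (Mu_L \<Gamma> X e \<Delta>) = (\<Gamma> \<union> {Mu X e}, \<Delta>)"
| "conclusion (Nu_L \<Gamma> X e \<Delta>) = (\<Gamma> \<union> {Nu X e}, \<Delta>)"
| "conclusion (Zero_R \<Gamma> \<Delta>) = (\<Gamma>, \<Delta> \<union> {Zero})"
| "conclusion (Top_R \<Gamma> \<Delta>) = (\<Gamma>, \<Delta> \<union> {Top})"
| "conclusion (Plus_R \<Gamma> \<Delta> e f) = (\<Gamma>, \<Delta> \<union> {Plus e f})"
| "conclusion (Inter_R \<Gamma> \<Delta> e f) = (\<Gamma>, \<Delta> \<union> {Inter e f})"
| "conclusion (Mu_R \<Gamma> \<Delta> X e) = (\<Gamma>, \<Delta> \<union> {Mu X e})"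
| "conclusion (Nu_R \<Gamma> \<Delta> X e) = (\<Gamma>, \<Delta> \<union> {Nu X e})"

primrec premisses :: "'a inference \<Rightarrow> 'a pos \<Rightarrow> 'a sequent option" where
  "premisses (P_L a e b f) = Map.empty"
| "premisses (H a \<Gamma> \<Delta>) = [Fst \<mapsto> (\<Gamma>, \<Delta>)]"
| "premisses (P_R G) = (\<lambda>p. case p of At a \<Rightarrow> Some ({}, G a) | _ \<Rightarrow> None)"
| "premisses (W_L \<Gamma> e \<Delta>) = [Fst \<mapsto> (\<Gamma>, \<Delta>)]"
| "premisses (W_R \<Gamma> \<Delta> e) = [Fst \<mapsto> (\<Gamma>, \<Delta>)]"
| "premisses (Zero_L \<Gamma> \<Delta>) = Map.empty"
| "premisses (Top_L \<Gamma> \<Delta>) = [Fst \<mapsto> (\<Gamma>, \<Delta>)]"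
| "premisses (Plus_L \<Gamma> e f \<Delta>) = [Fst \<mapsto> (\<Gamma> \<union> {e}, \<Delta>), Snd \<mapsto> (\<Gamma> \<union> {f}, \<Delta>)]"
| "premisses (Inter_L \<Gamma> e f \<Delta>) = [Fst \<mapsto> (\<Gamma> \<union> {e, f}, \<Delta>)]"
| "premisses (Mu_L \<Gamma> X e \<Delta>) = [Fst \<mapsto> (\<Gamma> \<union> {subst X (Mu X e) e}, \<Delta>)]"
| "premisses (Nu_L \<Gamma> X e \<Delta>) = [Fst \<mapsto> (\<Gamma> \<union> {subst X (Nu X e) e}, \<Delta>)]"
| "premisses (Zero_R \<Gamma> \<Delta>) = [Fst \<mapsto> (\<Gamma>, \<Delta>)]"
| "premisses (Top_R \<Gamma> \<Delta>) = Map.empty"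
| "premisses (Plus_R \<Gamma> \<Delta> e f) = [Fst \<mapsto> (\<Gamma>, \<Delta> \<union> {e, f})]"
| "premisses (Inter_R \<Gamma> \<Delta> e f) = [Fst \<mapsto> (\<Gamma>, \<Delta> \<union> {e}), Snd \<mapsto> (\<Gamma>, \<Delta> \<union> {f})]"
| "premisses (Mu_R \<Gamma> \<Delta> X e) = [Fst \<mapsto> (\<Gamma>, \<Delta> \<union> {subst X (Mu X e) e})]"
| "premisses (Nu_R \<Gamma> \<Delta> X e) = [Fst \<mapsto> (\<Gamma>, \<Delta> \<union> {subst X (Nu X e) e})]"

text \<open>The principal formula with its side; \<open>None\<close> for exactly the letter rules.\<close>

primrec principal :: "'a inference \<Rightarrow> (side \<times> 'a exp) option" where
  "principal (P_L a e b f) = None"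
| "principal (H a \<Gamma> \<Delta>) = None"
| "principal (P_R G) = None"
| "principal (W_L \<Gamma> e \<Delta>) = Some (LHS, e)"
| "principal (W_R \<Gamma> \<Delta> e) = Some (RHS, e)"
| "principal (Zero_L \<Gamma> \<Delta>) = Some (LHS, Zero)"
| "principal (Top_L \<Gamma> \<Delta>) = Some (LHS, Top)"
| "principal (Plus_L \<Gamma> e f \<Delta>) = Some (LHS, Plus e f)"
| "principal (Inter_L \<Gamma> e f \<Delta>) = Some (LHS, Inter e f)"
| "principal (Mu_L \<Gamma> X e \<Delta>) = Some (LHS, Mu X e)"
| "principal (Nu_L \<Gamma> X e \<Delta>) = Some (LHS, Nu X e)"
| "principal (Zero_R \<Gamma> \<Delta>) = Some (RHS, Zero)"
| "principal (Top_R \<Gamma> \<Delta>) = Some (RHS, Top)"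
| "principal (Plus_R \<Gamma> \<Delta> e f) = Some (RHS, Plus e f)"
| "principal (Inter_R \<Gamma> \<Delta> e f) = Some (RHS, Inter e f)"
| "principal (Mu_R \<Gamma> \<Delta> X e) = Some (RHS, Mu X e)"
| "principal (Nu_R \<Gamma> \<Delta> X e) = Some (RHS, Nu X e)"

text \<open>The auxiliary formulas of the premiss at a given position; they are on the side of the
  principal formula.\<close>

primrec auxiliary :: "'a inference \<Rightarrow> 'a pos \<Rightarrow> 'a exp set" where
  "auxiliary (P_L a e b f) p = {}"
| "auxiliary (H a \<Gamma> \<Delta>) p = {}"
| "auxiliary (P_R G) p = {}"
| "auxiliary (W_L \<Gamma> e \<Delta>) p = {}"
| "auxiliary (W_R \<Gamma> \<Delta> e) p = {}"
| "auxiliary (Zero_L \<Gamma> \<Delta>) p = {}"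
| "auxiliary (Top_L \<Gamma> \<Delta>) p = {}"
| "auxiliary (Plus_L \<Gamma> e f \<Delta>) p = (if p = Fst then {e} else if p = Snd then {f} else {})"
| "auxiliary (Inter_L \<Gamma> e f \<Delta>) p = (if p = Fst then {e, f} else {})"
| "auxiliary (Mu_L \<Gamma> X e \<Delta>) p = (if p = Fst then {subst X (Mu X e) e} else {})"
| "auxiliary (Nu_L \<Gamma> X e \<Delta>) p = (if p = Fst then {subst X (Nu X e) e} else {})"
| "auxiliary (Zero_R \<Gamma> \<Delta>) p = {}"
| "auxiliary (Top_R \<Gamma> \<Delta>) p = {}"
| "auxiliary (Plus_R \<Gamma> \<Delta> e f) p = (if p = Fst then {e, f} else {})"
| "auxiliary (Inter_R \<Gamma> \<Delta> e f) p = (if p = Fst then {e} else if p = Snd then {f} else {})"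
| "auxiliary (Mu_R \<Gamma> \<Delta> X e) p = (if p = Fst then {subst X (Mu X e) e} else {})"
| "auxiliary (Nu_R \<Gamma> \<Delta> X e) p = (if p = Fst then {subst X (Nu X e) e} else {})"

text \<open>\<open>active r p s e e'\<close>: on side \<open>s\<close>, the formula \<open>e\<close> is principal in the step \<open>r\<close> and \<open>e'\<close> is
  auxiliary in its premiss at \<open>p\<close>.\<close>

definition active :: "'a inference \<Rightarrow> 'a pos \<Rightarrow> side \<Rightarrow> 'a exp \<Rightarrow> 'a exp \<Rightarrow> bool" where
  "active r p s e e' \<longleftrightarrow> principal r = Some (s, e) \<and> e' \<in> auxiliary r p"

text \<open>\<open>ancestor r p s e e'\<close>: the formula \<open>e'\<close> on side \<open>s\<close> of the premiss at \<open>p\<close> is an immediate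
  ancestor of the formula \<open>e\<close> on side \<open>s\<close> of the conclusion. The clause \<open>e = e'\<close> is that of the side
  formulas of structural and logical steps. It must not apply to letter steps, which have
  no side formulas: there \<open>Act a e\<close> may happen to be an element of both the conclusion and
  the premiss, but linking the two would be unsound.\<close>

inductive ancestor :: "'a inference \<Rightarrow> 'a pos \<Rightarrow> side \<Rightarrow> 'a exp \<Rightarrow> 'a exp \<Rightarrow> bool" where
  anc_active: "active r p s e e' \<Longrightarrow> ancestor r p s e e'"
| anc_H: "e' \<in> formulas s (\<Gamma>, \<Delta>) \<Longrightarrow> ancestor (H a \<Gamma> \<Delta>) Fst s (Act a e') e'"
| anc_P_R: "e' \<in> G a \<Longrightarrow> ancestor (P_R G) (At a) RHS (Act a e') e'"
| anc_side: "principal r \<noteq> None \<Longrightarrow> e \<in> formulas s (conclusion r) \<Longrightarrow>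
    premisses r p = Some S \<Longrightarrow> e \<in> formulas s S \<Longrightarrow> ancestor r p s e e"

section \<open>Preproofs and proofs\<close>

codatatype 'a tree = Node (step: "'a inference") (children: "'a pos \<Rightarrow> 'a tree option")

definition end_sequent :: "'a tree \<Rightarrow> 'a sequent" where
  "end_sequent t = conclusion (step t)"

inductive_set subtrees :: "'a tree \<Rightarrow> 'a tree set" for t where
  subtrees_self: "t \<in> subtrees t"
| subtrees_child: "u \<in> subtrees t \<Longrightarrow> children u p = Some v \<Longrightarrow> v \<in> subtrees t"

definition preproof :: "'a tree \<Rightarrow> bool" where
  "preproof t \<longleftrightarrow> (\<forall>u \<in> subtrees t. is_sequent (end_sequent u) \<and> side_condition (step u) \<and>
     (\<forall>p. map_option end_sequent (children u p) = premisses (step u) p))"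

definition regular :: "'a tree \<Rightarrow> bool" where
  "regular t \<longleftrightarrow> finite (subtrees t)"

definition infinite_branch :: "'a tree \<Rightarrow> (nat \<Rightarrow> 'a tree) \<Rightarrow> (nat \<Rightarrow> 'a pos) \<Rightarrow> bool" where
  "infinite_branch t u p \<longleftrightarrow> u 0 = t \<and> (\<forall>i. children (u i) (p i) = Some (u (Suc i)))"

text \<open>Every formula of a premiss is an immediate ancestor of some formula of the
  conclusion, so the infinite maximal paths are those that start at the root.\<close>

definition infinite_trace ::
  "(nat \<Rightarrow> 'a tree) \<Rightarrow> (nat \<Rightarrow> 'a pos) \<Rightarrow> side \<Rightarrow> (nat \<Rightarrow> 'a exp) \<Rightarrow> bool" where
  "infinite_trace u p s \<tau> \<longleftrightarrow>
     (\<forall>i. \<tau> i \<in> formulas s (end_sequent (u i)) \<and> ancestor (step (u i)) (p i) s (\<tau> i) (\<tau> (Suc i)))"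

text \<open>The formulas at which a trace is infinitely often principal. Since contexts are sets, the
  principal formula \<open>e\<close> of a step may also be a side formula of it; a trace that follows the side
  formula \<open>e\<close> is not principal at this step.\<close>

definition inf_principal ::
  "(nat \<Rightarrow> 'a tree) \<Rightarrow> (nat \<Rightarrow> 'a pos) \<Rightarrow> side \<Rightarrow> (nat \<Rightarrow> 'a exp) \<Rightarrow> 'a exp set" where
  "inf_principal u p s \<tau> =
     {e. \<exists>\<^sub>\<infinity>i. \<tau> i = e \<and> active (step (u i)) (p i) s (\<tau> i) (\<tau> (Suc i))}"

primrec progress_formula :: "side \<Rightarrow> 'a exp \<Rightarrow> bool" where
  "progress_formula LHS e = (\<exists>X f. e = Mu X f)"
| "progress_formula RHS e = (\<exists>X f. e = Nu X f)"

definition progressing_trace ::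
  "(nat \<Rightarrow> 'a tree) \<Rightarrow> (nat \<Rightarrow> 'a pos) \<Rightarrow> side \<Rightarrow> (nat \<Rightarrow> 'a exp) \<Rightarrow> bool" where
  "progressing_trace u p s \<tau> \<longleftrightarrow> infinite_trace u p s \<tau> \<and>
     (\<exists>e \<in> inf_principal u p s \<tau>. (\<forall>f \<in> inf_principal u p s \<tau>. e \<sqsubseteq> f) \<and> progress_formula s e)"

definition progressing :: "'a tree \<Rightarrow> bool" where
  "progressing t \<longleftrightarrow> (\<forall>u p. infinite_branch t u p \<longrightarrow> (\<exists>s \<tau>. progressing_trace u p s \<tau>))"

definition CRLL_proof :: "'a tree \<Rightarrow> bool" where
  "CRLL_proof t \<longleftrightarrow> preproof t \<and> regular t \<and> progressing t"

end

theory Submission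
  imports Defs
begin

text \<open>
  Both directions compare traces with signatures. Call a formula satisfied by a word on the left if
  the word belongs to its language and on the right if it does not; on either side, the progress
  formulas of that side are then the least fixed points. A satisfied formula carries a signature: a
  vector of ordinals, one for each progress formula of the finite Fischer-Ladner closure, the
  smaller formulas coming first, that is lexicographically least such that the formula stays satisfied
  when every progress formula is replaced by its approximant at that ordinal. Following a trace, the
  disjunctive choices can be made so that no component of the signature grows unless a smaller fixed
  point is unfolded, and unfolding a progress formula decreases its own component. Hence a trace along
  which the formulas stay satisfied cannot progress.

  Soundness: a word refuting the end sequent of a proof singles out an infinite branch, with choices
  made by signatures, all of whose traces consist of satisfied formulas and so do not progress.

  Completeness: up to the order of steps, proof search is deterministic, because the logical rules
  are invertible, the letter rules leave no choice,
    and guardedness makes the logical phases terminate.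
  The search tree is regular since there are finitely many sequents over the closure. An infinite branch
  spells a word, which by validity violates some formula of the end sequent. From that formula, signatures
  of the opposite side select a trace of violated formulas along the branch. The least formula which is
  infinitely often principal on this trace is not a progress formula of the opposite side, so it is one
  of its own side.
\<close>

section \<open>Two-sided semantics with interpreted fixed points\<close>

definition sat :: "side \<Rightarrow> 'a exp \<Rightarrow> 'a stream set" where
  "sat s e = (case s of LHS \<Rightarrow> lang e | RHS \<Rightarrow> - lang e)"

definition fixpt :: "bool \<Rightarrow> ('b set \<Rightarrow> 'b set) \<Rightarrow> 'b set" where
  "fixpt b F = (if b then lfp F else gfp F)"

lemma fixpt_mono: "(\<And>Z. F Z \<subseteq> G Z) \<Longrightarrow> fixpt b F \<subseteq> fixpt b G"
  by (simp add: fixpt_def lfp_mono gfp_mono)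

lemma fixpt_unfold: "mono F \<Longrightarrow> fixpt b F = F (fixpt b F)"
  unfolding fixpt_def using lfp_unfold[of F] gfp_unfold[of F] by auto

text \<open>On \<open>RHS\<close> this is the complement semantics. The partial map \<open>A\<close> overrides the meaning of the
  fixed point formulas in its domain.\<close>

primrec gsem :: "side \<Rightarrow> ('a exp \<Rightarrow> 'a stream set option) \<Rightarrow> (nat \<Rightarrow> 'a stream set) \<Rightarrow>
    'a exp \<Rightarrow> 'a stream set" where
  "gsem s A \<rho> (Var X) = \<rho> X"
| "gsem s A \<rho> (Act a e) = (if s = LHS then {w. shd w = a \<and> stl w \<in> gsem s A \<rho> e}
     else {w. shd w = a \<longrightarrow> stl w \<in> gsem s A \<rho> e})"
| "gsem s A \<rho> Zero = (if s = LHS then {} else UNIV)"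
| "gsem s A \<rho> (Plus e f) = (if s = LHS then gsem s A \<rho> e \<union> gsem s A \<rho> f
     else gsem s A \<rho> e \<inter> gsem s A \<rho> f)"
| "gsem s A \<rho> (Mu X e) = (case A (Mu X e) of Some S \<Rightarrow> S
     | None \<Rightarrow> fixpt (s = LHS) (\<lambda>Z. gsem s A (\<rho>(X := Z)) e))"
| "gsem s A \<rho> Top = (if s = LHS then UNIV else {})"
| "gsem s A \<rho> (Inter e f) = (if s = LHS then gsem s A \<rho> e \<inter> gsem s A \<rho> f
     else gsem s A \<rho> e \<union> gsem s A \<rho> f)"
| "gsem s A \<rho> (Nu X e) = (case A (Nu X e) of Some S \<Rightarrow> S
     | None \<Rightarrow> fixpt (s = RHS) (\<lambda>Z. gsem s A (\<rho>(X := Z)) e))"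

lemma gsem_mono: "(\<And>X. \<rho> X \<subseteq> \<rho>' X) \<Longrightarrow> gsem s A \<rho> e \<subseteq> gsem s A \<rho>' e"
proof (induction e arbitrary: \<rho> \<rho>')
  case (Act a e)
  have "gsem s A \<rho> e \<subseteq> gsem s A \<rho>' e"
    by (rule Act.IH, rule Act.prems)+
  then show ?case by auto
next
  case (Plus e f)
  have "gsem s A \<rho> e \<subseteq> gsem s A \<rho>' e" "gsem s A \<rho> f \<subseteq> gsem s A \<rho>' f"
    by (rule Plus.IH, rule Plus.prems)+
  then show ?case by auto
next
  case (Inter e f)
  have "gsem s A \<rho> e \<subseteq> gsem s A \<rho>' e" "gsem s A \<rho> f \<subseteq> gsem s A \<rho>' f"
    by (rule Inter.IH, rule Inter.prems)+
  then show ?case by auto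
next
  case (Mu X e)
  have "gsem s A (\<rho>(X := Z)) e \<subseteq> gsem s A (\<rho>'(X := Z)) e" for Z
    by (rule Mu.IH) (use Mu.prems in simp)
  then show ?case by (simp add: fixpt_mono split: option.split)
next
  case (Nu X e)
  have "gsem s A (\<rho>(X := Z)) e \<subseteq> gsem s A (\<rho>'(X := Z)) e" for Z
    by (rule Nu.IH) (use Nu.prems in simp)
  then show ?case by (simp add: fixpt_mono split: option.split)
qed auto

lemma gsem_upd_mono: "mono (\<lambda>Z. gsem s A (\<rho>(X := Z)) e)"
  by (intro monoI gsem_mono) auto

lemma gsem_cong:
  assumes "\<And>X. X \<in> fv e \<Longrightarrow> \<rho> X = \<rho>' X" "\<And>f. f \<in> subexps e \<Longrightarrow> A f = A' f"
  shows "gsem s A \<rho> e = gsem s A' \<rho>' e"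
  using assms
proof (induction e arbitrary: \<rho> \<rho>')
  case (Act a e)
  have "gsem s A \<rho> e = gsem s A' \<rho>' e" by (rule Act.IH) (use Act.prems in auto)
  then show ?case by (simp only: gsem.simps)
next
  case (Plus e f)
  have "gsem s A \<rho> e = gsem s A' \<rho>' e" "gsem s A \<rho> f = gsem s A' \<rho>' f"
    by (rule Plus.IH; use Plus.prems in auto)+
  then show ?case by (simp only: gsem.simps)
next
  case (Inter e f)
  have "gsem s A \<rho> e = gsem s A' \<rho>' e" "gsem s A \<rho> f = gsem s A' \<rho>' f"
    by (rule Inter.IH; use Inter.prems in auto)+
  then show ?case by (simp only: gsem.simps)
next
  case (Mu X e)
  have "gsem s A (\<rho>(X := Z)) e = gsem s A' (\<rho>'(X := Z)) e" for Z
    by (rule Mu.IH) (use Mu.prems in auto)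
  with Mu.prems(2)[of "Mu X e"] show ?case by (simp split: option.split)
next
  case (Nu X e)
  have "gsem s A (\<rho>(X := Z)) e = gsem s A' (\<rho>'(X := Z)) e" for Z
    by (rule Nu.IH) (use Nu.prems in auto)
  with Nu.prems(2)[of "Nu X e"] show ?case by (simp split: option.split)
qed auto

lemma gsem_closed: "closed_exp e \<Longrightarrow> gsem s A \<rho> e = gsem s A \<rho>' e"
  by (rule gsem_cong) (auto simp: closed_exp_def)

section \<open>Agreement with the language semantics and its complement\<close>

lemma gsem_LHS_empty: "gsem LHS Map.empty \<rho> e = sem \<rho> e"
proof (induction e arbitrary: \<rho>)
  case (Act a e)
  show ?case
    by (auto simp: Act image_iff) (metis stream.collapse)
qed (auto simp: fixpt_def lfp_def gfp_def)

text \<open>\<open>Z\<close> is a prefixed point of \<open>F\<close> iff its complement is a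
  postfixed point of the dual operator \<open>\<lambda>Z. - F (- Z)\<close>. This lemma and the next
  exchange least and greatest fixed points on the right-hand side.\<close>

lemma compl_Inter_prefixed: "- \<Inter>{Z. F Z \<subseteq> Z} = gfp (\<lambda>Z. - F (- Z))"
  unfolding gfp_def
proof (intro set_eqI iffI)
  fix x assume "x \<in> - \<Inter>{Z. F Z \<subseteq> Z}"
  then obtain Z where "F Z \<subseteq> Z" "x \<notin> Z" by auto
  then show "x \<in> \<Union>{u. u \<subseteq> - F (- u)}" by (intro UnionI[of "- Z"]) auto
next
  fix x assume "x \<in> \<Union>{u. u \<subseteq> - F (- u)}"
  then obtain u where "u \<subseteq> - F (- u)" "x \<in> u" by auto
  then have "F (- u) \<subseteq> - u" "x \<notin> - u" by auto
  then show "x \<in> - \<Inter>{Z. F Z \<subseteq> Z}" by blast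
qed

lemma compl_Union_postfixed: "- \<Union>{Z. Z \<subseteq> F Z} = lfp (\<lambda>Z. - F (- Z))"
  unfolding lfp_def
proof (intro set_eqI iffI)
  fix x assume "x \<in> \<Inter>{u. - F (- u) \<subseteq> u}"
  then have *: "- F (- u) \<subseteq> u \<Longrightarrow> x \<in> u" for u by auto
  show "x \<in> - \<Union>{Z. Z \<subseteq> F Z}"
  proof
    assume "x \<in> \<Union>{Z. Z \<subseteq> F Z}"
    then obtain Z where "Z \<subseteq> F Z" "x \<in> Z" by auto
    with *[of "- Z"] show False by auto
  qed
next
  fix x assume x: "x \<in> - \<Union>{Z. Z \<subseteq> F Z}"
  show "x \<in> \<Inter>{u. - F (- u) \<subseteq> u}"
  proof (intro InterI, clarify, rule ccontr)
    fix u assume "- F (- u) \<subseteq> u" "x \<notin> u"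
    then have "- u \<subseteq> F (- u)" "x \<in> - u" by auto
    with x show False by blast
  qed
qed

text \<open>The environment is complemented too: under a binder the variable then ranges over
  complements, which is the form in which the duality of fixed points applies.\<close>

lemma gsem_RHS_empty: "gsem RHS Map.empty \<rho> e = - sem (\<lambda>X. - \<rho> X) e"
proof (induction e arbitrary: \<rho>)
  case (Act a e)
  show ?case
    by (auto simp: Act image_iff) (metis stream.collapse)
next
  case (Mu X e)
  have "(\<lambda>Xa. - (\<rho>(X := Z)) Xa) = (\<lambda>X. - \<rho> X)(X := - Z)" for Z by (auto simp: fun_eq_iff)
  then show ?case by (simp add: Mu compl_Inter_prefixed fixpt_def)
next
  case (Nu X e)
  have "(\<lambda>Xa. - (\<rho>(X := Z)) Xa) = (\<lambda>X. - \<rho> X)(X := - Z)" for Z by (auto simp: fun_eq_iff)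
  then show ?case by (simp add: Nu compl_Union_postfixed fixpt_def)
qed auto

lemma gsem_empty: "closed_exp e \<Longrightarrow> gsem s Map.empty \<rho> e = sat s e"
  by (cases s) (simp_all add: gsem_LHS_empty gsem_RHS_empty sat_def sem_closed)

section \<open>Substitution under overriding interpretations\<close>

lemma subexps_size: "f \<in> subexps e \<Longrightarrow> f = e \<or> size f < size e"
  by (induction e) auto

lemma subst_fresh: "X \<notin> fv e \<Longrightarrow> subst X g e = e"
  by (induction e) auto

lemma size_subst: "X \<in> fv e \<Longrightarrow> size g \<le> size (subst X g e)"
  by (induction e) (auto split: if_splits)

text \<open>The size conditions prevent \<open>A\<close> from interpreting the fixed point formulas that the substitution
  creates: these properly contain \<open>M\<close>.\<close>

lemma gsem_subst:
  assumes "closed_exp M" and A: "\<And>N. A N \<noteq> None \<Longrightarrow> closed_exp N \<and> size N \<le> size M"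
    and A': "\<And>N. N \<noteq> M \<Longrightarrow> A' N = A N" and "size e < size M"
  shows "gsem s A' \<rho> (subst X M e) = gsem s A (\<rho>(X := gsem s A' \<rho>' M)) e"
  using assms(4)
proof (induction e arbitrary: \<rho>)
  case (Var Y)
  then show ?case using gsem_closed[OF assms(1)] by auto
next
  case (Mu Y e)
  show ?case
  proof (cases "Y = X")
    case True
    have "gsem s A' (\<rho>(Y := Z)) e = gsem s A (\<rho>(Y := Z)) e" for Z
      by (rule gsem_cong) (use Mu.prems in \<open>auto intro!: A' dest: subexps_size\<close>)
    moreover have "A' (Mu Y e) = A (Mu Y e)" using Mu.prems by (intro A') auto
    ultimately show ?thesis unfolding True by (simp split: option.split flip: fun_upd_def)
  next
    case False
    have IH: "gsem s A' (\<rho>(Y := Z)) (subst X M e) = gsem s A (\<rho>(Y := Z, X := gsem s A' \<rho>' M)) e"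
      for Z
      by (rule Mu.IH) (use Mu.prems in auto)
    \<comment> \<open>If \<open>X\<close> is free in the body, the original formula is open and the
      substituted one is larger than \<open>M\<close>, so neither is in the domain of
      \<open>A\<close>. Otherwise the substitution does nothing.\<close>
    have "A' (Mu Y (subst X M e)) = A (Mu Y e)"
    proof (cases "X \<in> fv e")
      case True
      with False have "\<not> closed_exp (Mu Y e)" by (auto simp: closed_exp_def)
      moreover have "size (Mu Y (subst X M e)) > size M" using size_subst[OF True, of M] by simp
      ultimately have "A (Mu Y e) = None" "A (Mu Y (subst X M e)) = None" "Mu Y (subst X M e) \<noteq> M"
        using A[of "Mu Y e"] A[of "Mu Y (subst X M e)"] by fastforce+
      then show ?thesis using A' by simp
    next
      case False
      then show ?thesis using Mu.prems by (auto simp: subst_fresh intro!: A')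
    qed
    then show ?thesis using False IH by (simp add: fun_upd_twist[of Y X] split: option.split flip: fun_upd_def)
  qed
next
  case (Nu Y e)
  show ?case
  proof (cases "Y = X")
    case True
    have "gsem s A' (\<rho>(Y := Z)) e = gsem s A (\<rho>(Y := Z)) e" for Z
      by (rule gsem_cong) (use Nu.prems in \<open>auto intro!: A' dest: subexps_size\<close>)
    moreover have "A' (Nu Y e) = A (Nu Y e)" using Nu.prems by (intro A') auto
    ultimately show ?thesis unfolding True by (simp split: option.split flip: fun_upd_def)
  next
    case False
    have IH: "gsem s A' (\<rho>(Y := Z)) (subst X M e) = gsem s A (\<rho>(Y := Z, X := gsem s A' \<rho>' M)) e"
      for Z
      by (rule Nu.IH) (use Nu.prems in auto)
    have "A' (Nu Y (subst X M e)) = A (Nu Y e)"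
    proof (cases "X \<in> fv e")
      case True
      with False have "\<not> closed_exp (Nu Y e)" by (auto simp: closed_exp_def)
      moreover have "size (Nu Y (subst X M e)) > size M" using size_subst[OF True, of M] by simp
      ultimately have "A (Nu Y e) = None" "A (Nu Y (subst X M e)) = None" "Nu Y (subst X M e) \<noteq> M"
        using A[of "Nu Y e"] A[of "Nu Y (subst X M e)"] by fastforce+
      then show ?thesis using A' by simp
    next
      case False
      then show ?thesis using Nu.prems by (auto simp: subst_fresh intro!: A')
    qed
    then show ?thesis using False IH by (simp add: fun_upd_twist[of Y X] split: option.split flip: fun_upd_def)
  qed
qed auto

section \<open>Approximants and signatures\<close>

definition wellord :: "'b rel" where
  "wellord = (SOME R. wf R \<and> trans R \<and> total R)"

lemma wf_wellord: "wf (wellord :: 'b rel)"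
  and trans_wellord: "trans (wellord :: 'b rel)"
  and total_wellord: "total (wellord :: 'b rel)"
proof -
  obtain r :: "'b rel" where r: "well_order_on UNIV r" using well_order_on by blast
  have "wf (r - Id) \<and> trans (r - Id) \<and> total (r - Id)"
    using r unfolding well_order_on_def linear_order_on_def partial_order_on_def preorder_on_def
    by (auto intro: trans_diff_Id)
  then have "wf (wellord :: 'b rel) \<and> trans (wellord :: 'b rel) \<and> total (wellord :: 'b rel)"
    unfolding wellord_def by (rule someI)
  then show "wf (wellord :: 'b rel)" "trans (wellord :: 'b rel)" "total (wellord :: 'b rel)" by auto
qed

text \<open>Sets of points serve as ordinals: by Cantor's theorem there are enough of them for the iteration
  to reach the least fixed point.\<close>

definition approximant :: "('b set \<Rightarrow> 'b set) \<Rightarrow> 'b set \<Rightarrow> 'b set" where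
  "approximant F = wfrec wellord (\<lambda>g \<alpha>. \<Union>\<beta>\<in>{\<beta>. (\<beta>, \<alpha>) \<in> wellord}. F (g \<beta>))"

lemma in_approximant_iff: "x \<in> approximant F \<alpha> \<longleftrightarrow> (\<exists>\<beta>. (\<beta>, \<alpha>) \<in> wellord \<and> x \<in> F (approximant F \<beta>))"
  by (subst def_wfrec[OF approximant_def[THEN eq_reflection] wf_wellord]) (auto simp: cut_apply)

lemma approximant_subset_lfp: "mono F \<Longrightarrow> approximant F \<alpha> \<subseteq> lfp F"
proof (induction \<alpha> rule: wf_induct_rule[OF wf_wellord])
  case (1 \<alpha>)
  have *: "F (approximant F \<beta>) \<subseteq> lfp F" if "(\<beta>, \<alpha>) \<in> wellord" for \<beta>
    using 1(1)[OF that 1(2)] lfp_unfold[OF 1(2)] monoD[OF 1(2)] by metis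
  show ?case
  proof
    fix x assume "x \<in> approximant F \<alpha>"
    then obtain \<beta> where "(\<beta>, \<alpha>) \<in> wellord" "x \<in> F (approximant F \<beta>)"
      unfolding in_approximant_iff[of x] by blast
    with * show "x \<in> lfp F" by blast
  qed
qed

text \<open>If no stage were the least fixed point, every stage \<alpha> would miss a point
  \<open>x \<alpha>\<close> that all later stages contain. Then \<open>x\<close> would inject the
  sets of points into the points, against Cantor's theorem.\<close>

lemma approximant_eq_lfp:
  fixes F :: "'b set \<Rightarrow> 'b set"
  assumes "mono F" shows "\<exists>\<alpha>. approximant F \<alpha> = lfp F"
proof (rule ccontr)
  assume neq: "\<not> ?thesis"
  have "\<exists>x. x \<in> F (approximant F \<alpha>) \<and> x \<notin> approximant F \<alpha>" for \<alpha>
  proof (rule ccontr)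
    assume "\<not> ?thesis"
    then have "lfp F \<subseteq> approximant F \<alpha>" by (intro lfp_lowerbound) auto
    with neq approximant_subset_lfp[OF assms] show False by blast
  qed
  then obtain x where x: "\<And>\<alpha>. x \<alpha> \<in> F (approximant F \<alpha>) \<and> x \<alpha> \<notin> approximant F \<alpha>" by metis
  have "inj x"
  proof (rule injI, rule ccontr)
    fix \<alpha> \<beta> assume eq: "x \<alpha> = x \<beta>" and "\<alpha> \<noteq> \<beta>"
    then consider "(\<alpha>, \<beta>) \<in> wellord" | "(\<beta>, \<alpha>) \<in> wellord"
      using total_wellord[unfolded total_on_def, rule_format, OF UNIV_I UNIV_I, of \<alpha> \<beta>] by blast
    then show False using x[of \<alpha>] x[of \<beta>] eq by cases (auto simp: in_approximant_iff)
  qed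
  then have "range (inv x) = (UNIV :: 'b set set)" by (simp add: inj_imp_surj_inv)
  then show False using Cantors_theorem[of "UNIV :: 'b set"] by (metis Pow_UNIV)
qed

section \<open>Fixed point formulas, their operators and their unfoldings\<close>

fun is_fix :: "'a exp \<Rightarrow> bool" where
  "is_fix (Mu X e) = True"
| "is_fix (Nu X e) = True"
| "is_fix _ = False"

fun unfold_fix :: "'a exp \<Rightarrow> 'a exp" where
  "unfold_fix (Mu X e) = subst X (Mu X e) e"
| "unfold_fix (Nu X e) = subst X (Nu X e) e"
| "unfold_fix e = e"

text \<open>The operator whose fixed point is meant. The empty default environment is harmless for a
  closed formula, whose body has at most \<open>X\<close> free; the last clause is a dummy.\<close>

fun body_sem :: "side \<Rightarrow> ('a exp \<Rightarrow> 'a stream set option) \<Rightarrow> 'a exp \<Rightarrow> 'a stream set \<Rightarrow> 'a stream set" where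
  "body_sem s A (Mu X e) Z = gsem s A ((\<lambda>_. {})(X := Z)) e"
| "body_sem s A (Nu X e) Z = gsem s A ((\<lambda>_. {})(X := Z)) e"
| "body_sem s A e Z = Z"

lemma body_sem_eq:
  "body_sem s A (Mu X e) = (\<lambda>Z. gsem s A ((\<lambda>_. {})(X := Z)) e)"
  "body_sem s A (Nu X e) = (\<lambda>Z. gsem s A ((\<lambda>_. {})(X := Z)) e)"
  by (simp_all add: fun_eq_iff)

lemma is_fix_cases:
  assumes "is_fix M" obtains X e where "M = Mu X e" | X e where "M = Nu X e"
  using assms by (cases M) auto

lemma progress_is_fix: "progress_formula s M \<Longrightarrow> is_fix M"
  by (cases s) auto

lemma body_sem_mono: "is_fix M \<Longrightarrow> mono (body_sem s A M)"
  by (erule is_fix_cases) (simp_all add: mono_def gsem_upd_mono[THEN monoD])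

lemma gsem_fix_Some: "is_fix M \<Longrightarrow> A M = Some S \<Longrightarrow> gsem s A \<rho> M = S"
  by (erule is_fix_cases) auto

lemma gsem_fix_None:
  assumes "is_fix M" "closed_exp M" "A M = None"
  shows "gsem s A \<rho> M = fixpt (progress_formula s M) (body_sem s A M)"
proof -
  have "gsem s A \<rho> M = gsem s A (\<lambda>_. {}) M" by (rule gsem_closed[OF assms(2)])
  also have "\<dots> = fixpt (progress_formula s M) (body_sem s A M)"
    using assms(1,3) by (cases s) (auto elim!: is_fix_cases simp: fixpt_def body_sem_eq)
  finally show ?thesis .
qed

text \<open>By the substitution lemma, the unfolding denotes one application of the operator of
  \<open>M\<close> to whatever \<open>A'\<close> makes of \<open>M\<close>. For progress formulas
  \<open>A'\<close> will assign an approximant to \<open>M\<close>; for other fixed points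
  \<open>A'\<close> will be \<open>A\<close>.\<close>

lemma gsem_unfold_fix:
  assumes "is_fix M" "closed_exp M" and A: "\<And>N. A N \<noteq> None \<Longrightarrow> closed_exp N \<and> size N \<le> size M"
    and A': "\<And>N. N \<noteq> M \<Longrightarrow> A' N = A N"
  shows "gsem s A' \<rho> (unfold_fix M) = body_sem s A M (gsem s A' \<rho>' M)"
  using assms(1)
proof (cases rule: is_fix_cases)
  case (1 X e)
  have "gsem s A' \<rho> (subst X M e) = gsem s A (\<rho>(X := gsem s A' \<rho>' M)) e"
    by (rule gsem_subst) (use assms(2) A A' 1 in auto)
  also have "\<dots> = gsem s A ((\<lambda>_. {})(X := gsem s A' \<rho>' M)) e"
    by (rule gsem_cong) (use assms(2) 1 in \<open>auto simp: closed_exp_def\<close>)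
  finally show ?thesis using 1 by simp
next
  case (2 X e)
  have "gsem s A' \<rho> (subst X M e) = gsem s A (\<rho>(X := gsem s A' \<rho>' M)) e"
    by (rule gsem_subst) (use assms(2) A A' 2 in auto)
  also have "\<dots> = gsem s A ((\<lambda>_. {})(X := gsem s A' \<rho>' M)) e"
    by (rule gsem_cong) (use assms(2) 2 in \<open>auto simp: closed_exp_def\<close>)
  finally show ?thesis using 2 by simp
qed

text \<open>Earlier formulas of the list are interpreted first, so that the approximants of a later
  formula are taken relative to those of its subformulas.\<close>

primrec approx_env :: "side \<Rightarrow> ('a exp \<Rightarrow> 'a stream set option) \<Rightarrow> 'a exp list \<Rightarrow> 'a stream set list \<Rightarrow>
    'a exp \<Rightarrow> 'a stream set option" where
  "approx_env s A [] \<alpha>s = A"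
| "approx_env s A (M # Ms) \<alpha>s = approx_env s (A(M \<mapsto> approximant (body_sem s A M) (hd \<alpha>s))) Ms (tl \<alpha>s)"

lemma approx_env_append: "length \<alpha>s = length Ms \<Longrightarrow>
    approx_env s A (Ms @ Ns) (\<alpha>s @ \<beta>s) = approx_env s (approx_env s A Ms \<alpha>s) Ns \<beta>s"
proof (induction Ms arbitrary: A \<alpha>s)
  case (Cons M Ms)
  then show ?case by (cases \<alpha>s) (auto simp flip: fun_upd_def)
qed simp

lemma approx_env_other: "N \<notin> set Ms \<Longrightarrow> approx_env s A Ms \<alpha>s N = A N"
  by (induction Ms arbitrary: A \<alpha>s) auto

text \<open>The override gives \<open>M\<close> the value it already has: a progress formula denotes
  the least fixed point of its operator.\<close>

lemma gsem_upd_lfp: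
  assumes M: "closed_exp M" "progress_formula s M" "A M = None"
  shows "gsem s (A(M \<mapsto> lfp (body_sem s A M))) \<rho> e = gsem s A \<rho> e"
proof (induction e arbitrary: \<rho>)
  case (Mu X e)
  show ?case
  proof (cases "Mu X e = M")
    case True
    have "gsem s A \<rho> M = lfp (body_sem s A M)"
      using gsem_fix_None[where A = A, OF progress_is_fix[OF M(2)] M(1,3), of s \<rho>] M(2)
        by (simp add: fixpt_def)
    moreover have "gsem s (A(M \<mapsto> lfp (body_sem s A M))) \<rho> M = lfp (body_sem s A M)"
      by (rule gsem_fix_Some[OF progress_is_fix[OF M(2)]]) simp
    ultimately show ?thesis unfolding True by (rule trans[OF _ sym, rotated])
  qed (simp add: Mu split: option.split flip: fun_upd_def)
next
  case (Nu X e)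
  show ?case
  proof (cases "Nu X e = M")
    case True
    have "gsem s A \<rho> M = lfp (body_sem s A M)"
      using gsem_fix_None[where A = A, OF progress_is_fix[OF M(2)] M(1,3), of s \<rho>] M(2)
        by (simp add: fixpt_def)
    moreover have "gsem s (A(M \<mapsto> lfp (body_sem s A M))) \<rho> M = lfp (body_sem s A M)"
      by (rule gsem_fix_Some[OF progress_is_fix[OF M(2)]]) simp
    ultimately show ?thesis unfolding True by (rule trans[OF _ sym, rotated])
  qed (simp add: Nu split: option.split flip: fun_upd_def)
qed (simp_all only: gsem.simps)

text \<open>Going through the list, pick for each formula an ordinal at which its approximants,
  taken relative to the earlier choices, have reached the least fixed point.\<close>

lemma approx_env_exact:
  assumes "distinct Ms" "\<And>M. M \<in> set Ms \<Longrightarrow> closed_exp M \<and> progress_formula s M \<and> A M = None"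
  shows "\<exists>\<alpha>s. length \<alpha>s = length Ms \<and> (\<forall>\<rho> e. gsem s (approx_env s A Ms \<alpha>s) \<rho> e = gsem s A \<rho> e)"
  using assms
proof (induction Ms arbitrary: A)
  case (Cons M Ms)
  have M: "closed_exp M" "progress_formula s M" "A M = None" using Cons.prems(2)[of M] by auto
  obtain \<alpha> where \<alpha>: "approximant (body_sem s A M) \<alpha> = lfp (body_sem s A M)"
    using approximant_eq_lfp[OF body_sem_mono[OF progress_is_fix[OF M(2)]]] by blast
  have "\<exists>\<alpha>s. length \<alpha>s = length Ms \<and> (\<forall>\<rho> e. gsem s (approx_env s (A(M \<mapsto> lfp (body_sem s A M))) Ms \<alpha>s) \<rho> e
      = gsem s (A(M \<mapsto> lfp (body_sem s A M))) \<rho> e)"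
    by (rule Cons.IH) (use Cons.prems in auto)
  then obtain \<alpha>s where "length \<alpha>s = length Ms"
    "\<forall>\<rho> e. gsem s (approx_env s (A(M \<mapsto> lfp (body_sem s A M))) Ms \<alpha>s) \<rho> e
      = gsem s (A(M \<mapsto> lfp (body_sem s A M))) \<rho> e" by blast
  then show ?case using gsem_upd_lfp[where A = A, OF M] \<alpha> by (intro exI[of _ "\<alpha> # \<alpha>s"]) simp
qed simp

text \<open>Sorting by size linearises the subformula order, so that the formulas inside
  \<open>M\<close> precede \<open>M\<close>.\<close>

definition progress_enum :: "side \<Rightarrow> 'a exp list \<Rightarrow> bool" where
  "progress_enum s Ms \<longleftrightarrow> sorted (map size Ms) \<and> distinct Ms \<and>
    (\<forall>M\<in>set Ms. closed_exp M \<and> progress_formula s M)"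

text \<open>The length condition makes all signatures comparable, because \<open>lex\<close> relates
  only lists of equal length.\<close>

definition sat_upto :: "side \<Rightarrow> 'a exp list \<Rightarrow> 'a stream set list \<Rightarrow> 'a exp \<Rightarrow> 'a stream \<Rightarrow> bool" where
  "sat_upto s Ms \<alpha>s e w \<longleftrightarrow>
    length \<alpha>s = length Ms \<and> w \<in> gsem s (approx_env s Map.empty Ms \<alpha>s) (\<lambda>_. {}) e"

lemma gsem_upd_subset:
  "S \<subseteq> S' \<Longrightarrow> gsem s (A(M \<mapsto> S)) \<rho> e \<subseteq> gsem s (A(M \<mapsto> S')) \<rho> e"
proof (induction e arbitrary: \<rho>)
  case (Mu X e)
  then have "gsem s (A(M \<mapsto> S)) (\<rho>(X := Z)) e \<subseteq> gsem s (A(M \<mapsto> S')) (\<rho>(X := Z)) e" for Z by blast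
  then show ?case using Mu.prems
    by (cases "M = Mu X e") (simp_all add: fixpt_mono split: option.split flip: fun_upd_def)
next
  case (Nu X e)
  then have "gsem s (A(M \<mapsto> S)) (\<rho>(X := Z)) e \<subseteq> gsem s (A(M \<mapsto> S')) (\<rho>(X := Z)) e" for Z by blast
  then show ?case using Nu.prems
    by (cases "M = Nu X e") (simp_all add: fixpt_mono split: option.split flip: fun_upd_def)
next
  case (Act a e)
  from Act.IH[OF Act.prems, of \<rho>] show ?case by auto
next
  case (Plus e f)
  from Plus.IH(1)[OF Plus.prems, of \<rho>] Plus.IH(2)[OF Plus.prems, of \<rho>] show ?case by auto
next
  case (Inter e f)
  from Inter.IH(1)[OF Inter.prems, of \<rho>] Inter.IH(2)[OF Inter.prems, of \<rho>] show ?case by auto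
qed auto

text \<open>Approximants lie below the least fixed point, the semantics is monotone in the
  overriding values, and overriding by the least fixed point itself changes nothing.\<close>

lemma gsem_approx_env_subset:
  assumes "distinct Ms" "\<And>M. M \<in> set Ms \<Longrightarrow> closed_exp M \<and> progress_formula s M \<and> A M = None"
  shows "gsem s (approx_env s A Ms \<alpha>s) \<rho> e \<subseteq> gsem s A \<rho> e"
  using assms
proof (induction Ms arbitrary: A \<alpha>s)
  case (Cons M Ms)
  have M: "closed_exp M" "progress_formula s M" "A M = None" using Cons.prems(2)[of M] by auto
  have "gsem s (approx_env s A (M # Ms) \<alpha>s) \<rho> e \<subseteq> gsem s (A(M \<mapsto> approximant (body_sem s A M) (hd \<alpha>s))) \<rho> e"
    unfolding approx_env.simps by (rule Cons.IH) (use Cons.prems in auto)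
  also have "\<dots> \<subseteq> gsem s (A(M \<mapsto> lfp (body_sem s A M))) \<rho> e"
    by (intro gsem_upd_subset approximant_subset_lfp body_sem_mono progress_is_fix[OF M(2)])
  also have "\<dots> = gsem s A \<rho> e" by (rule gsem_upd_lfp[where A = A, OF M])
  finally show ?case .
qed simp

lemma sat_upto_imp_sat:
  assumes "progress_enum s Ms" "closed_exp e" "sat_upto s Ms \<alpha>s e w"
  shows "w \<in> sat s e"
proof -
  have "gsem s (approx_env s Map.empty Ms \<alpha>s) (\<lambda>_. {}) e \<subseteq> gsem s Map.empty (\<lambda>_. {}) e"
    by (rule gsem_approx_env_subset) (use assms in \<open>auto simp: progress_enum_def\<close>)
  then show ?thesis using assms by (auto simp: sat_upto_def gsem_empty)
qed

lemma sat_imp_sat_upto: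
  assumes "progress_enum s Ms" "closed_exp e" "w \<in> sat s e"
  shows "\<exists>\<alpha>s. sat_upto s Ms \<alpha>s e w"
  using approx_env_exact[of Ms s Map.empty] assms unfolding progress_enum_def sat_upto_def
  by (metis gsem_empty)

text \<open>A word enters the approximant at \<alpha> through one application of the operator to the
  approximant at some smaller \<beta>. The components before that of \<open>M\<close> are kept;
  those after it are chosen anew, by exactness, and may grow.\<close>

lemma sat_upto_unfold_progress:
  assumes wf: "progress_enum s (Ms1 @ M # Ms2)" and len: "length \<alpha>s1 = length Ms1"
    and g: "sat_upto s (Ms1 @ M # Ms2) (\<alpha>s1 @ \<alpha> # \<alpha>s2) M w"
  shows "\<exists>\<beta> \<beta>s2. (\<beta>, \<alpha>) \<in> wellord \<and> sat_upto s (Ms1 @ M # Ms2) (\<alpha>s1 @ \<beta> # \<beta>s2) (unfold_fix M) w"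
proof -
  define A where "A = approx_env s Map.empty Ms1 \<alpha>s1"
  have M: "closed_exp M" "progress_formula s M" "is_fix M" "M \<notin> set Ms1" "M \<notin> set Ms2"
    using wf progress_is_fix by (auto simp: progress_enum_def)
  have A_None: "A N = None" if "N \<notin> set Ms1" for N
    using approx_env_other[OF that] by (simp add: A_def)
  have dom: "closed_exp N \<and> size N \<le> size M" if "A N \<noteq> None" for N
  proof -
    have "N \<in> set Ms1" using A_None[of N] that by auto
    then show ?thesis using wf by (auto simp: progress_enum_def sorted_append)
  qed
  have "gsem s (approx_env s Map.empty (Ms1 @ M # Ms2) (\<alpha>s1 @ \<alpha> # \<alpha>s2)) (\<lambda>_. {}) M = approximant (body_sem s A M) \<alpha>"
    by (rule gsem_fix_Some[OF M(3)]) (use M(5) in \<open>simp add: approx_env_append[OF len] approx_env_other A_def\<close>)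
  with g obtain \<beta> where \<beta>: "(\<beta>, \<alpha>) \<in> wellord" "w \<in> body_sem s A M (approximant (body_sem s A M) \<beta>)"
    by (auto simp: sat_upto_def in_approximant_iff[of w])
  define A' where "A' = A(M \<mapsto> approximant (body_sem s A M) \<beta>)"
  have "gsem s A' (\<lambda>_. {}) (unfold_fix M) = body_sem s A M (gsem s A' (\<lambda>_. {}) M)"
    by (rule gsem_unfold_fix[OF M(3,1) dom]) (auto simp: A'_def)
  also have "gsem s A' (\<lambda>_. {}) M = approximant (body_sem s A M) \<beta>"
    by (rule gsem_fix_Some[OF M(3)]) (simp add: A'_def)
  finally have w: "w \<in> gsem s A' (\<lambda>_. {}) (unfold_fix M)" using \<beta>(2) by simp
  have "\<exists>\<beta>s. length \<beta>s = length Ms2 \<and> (\<forall>\<rho> e. gsem s (approx_env s A' Ms2 \<beta>s) \<rho> e = gsem s A' \<rho> e)"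
    by (rule approx_env_exact) (use wf A_None in \<open>auto simp: progress_enum_def A'_def\<close>)
  then obtain \<beta>s where "length \<beta>s = length Ms2"
    "w \<in> gsem s (approx_env s A' Ms2 \<beta>s) (\<lambda>_. {}) (unfold_fix M)"
    using w by auto
  then have "sat_upto s (Ms1 @ M # Ms2) (\<alpha>s1 @ \<beta> # \<beta>s) (unfold_fix M) w"
    using len by (simp add: sat_upto_def approx_env_append A'_def A_def)
  with \<beta>(1) show ?thesis by blast
qed

text \<open>\<open>N\<close> is not overridden, and formulas larger than \<open>N\<close> do not
  occur in it, so its value depends only on the components for \<open>Ms1\<close> and equals that of
  its unfolding. The components for \<open>Ms2\<close> are chosen anew, by exactness.\<close>

lemma sat_upto_unfold_other:
  assumes wf: "progress_enum s (Ms1 @ Ms2)" and len: "length \<alpha>s1 = length Ms1"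
    and N: "is_fix N" "closed_exp N" "\<not> progress_formula s N"
    and small: "\<And>M. M \<in> set Ms1 \<Longrightarrow> size M \<le> size N"
    and large: "\<And>M. M \<in> set Ms2 \<Longrightarrow> size N < size M"
    and g: "sat_upto s (Ms1 @ Ms2) (\<alpha>s1 @ \<alpha>s2) N w"
  shows "\<exists>\<beta>s2. sat_upto s (Ms1 @ Ms2) (\<alpha>s1 @ \<beta>s2) (unfold_fix N) w"
proof -
  define A where "A = approx_env s Map.empty Ms1 \<alpha>s1"
  have A_None: "A M = None" if "M \<notin> set Ms1" for M
    using approx_env_other[OF that] by (simp add: A_def)
  have dom: "closed_exp M \<and> size M \<le> size N" if "A M \<noteq> None" for M
  proof -
    have "M \<in> set Ms1" using A_None[of M] that by auto
    then show ?thesis using wf small by (auto simp: progress_enum_def sorted_append)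
  qed
  have "A N = None" using N(3) wf by (intro A_None) (auto simp: progress_enum_def)
  then have N_fix: "gsem s A (\<lambda>_. {}) N = fixpt False (body_sem s A N)"
    using gsem_fix_None[OF N(1,2)] N(3) by simp
  have "gsem s (approx_env s A Ms2 \<alpha>s2) (\<lambda>_. {}) N = gsem s A (\<lambda>_. {}) N"
  proof (rule gsem_cong)
    fix f assume "f \<in> subexps N"
    then have "f \<notin> set Ms2" using subexps_size large by fastforce
    then show "approx_env s A Ms2 \<alpha>s2 f = A f" by (rule approx_env_other)
  qed simp
  with g have "w \<in> gsem s A (\<lambda>_. {}) N"
    using len by (simp add: sat_upto_def approx_env_append A_def)
  also have "gsem s A (\<lambda>_. {}) N = body_sem s A N (gsem s A (\<lambda>_. {}) N)"
    unfolding N_fix by (rule fixpt_unfold[OF body_sem_mono[OF N(1)]])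
  also have "\<dots> = gsem s A (\<lambda>_. {}) (unfold_fix N)"
    by (rule gsem_unfold_fix[OF N(1,2) dom, symmetric]) auto
  finally have w: "w \<in> gsem s A (\<lambda>_. {}) (unfold_fix N)" .
  have "\<exists>\<beta>s. length \<beta>s = length Ms2 \<and> (\<forall>\<rho> e. gsem s (approx_env s A Ms2 \<beta>s) \<rho> e = gsem s A \<rho> e)"
    by (rule approx_env_exact) (use wf A_None in \<open>auto simp: progress_enum_def\<close>)
  then obtain \<beta>s where "length \<beta>s = length Ms2"
    "w \<in> gsem s (approx_env s A Ms2 \<beta>s) (\<lambda>_. {}) (unfold_fix N)"
    using w by auto
  then have "sat_upto s (Ms1 @ Ms2) (\<alpha>s1 @ \<beta>s) (unfold_fix N) w"
    using len by (simp add: sat_upto_def approx_env_append A_def)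
  then show ?thesis by blast
qed

section \<open>Lexicographically least signatures\<close>

definition lex_le :: "'b list \<Rightarrow> 'b list \<Rightarrow> bool" where
  "lex_le xs ys \<longleftrightarrow> xs = ys \<or> (xs, ys) \<in> lex wellord"

lemma lex_wellord_total: "length xs = length ys \<Longrightarrow> lex_le xs ys \<or> (ys, xs) \<in> lex wellord"
  by (induction xs ys rule: list_induct2)
    (use total_wellord in \<open>auto simp: lex_le_def total_on_def\<close>)

lemma lex_le_take: "lex_le xs ys \<Longrightarrow> lex_le (take k xs) (take k ys)"
proof (induction xs arbitrary: ys k)
  case (Cons x xs)
  show ?case
  proof (cases "x # xs = ys")
    case False
    with Cons.prems have l: "(x # xs, ys) \<in> lex wellord" by (simp add: lex_le_def)
    then obtain y ys' where ys: "ys = y # ys'" by (cases ys) auto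
    show ?thesis
    proof (cases k)
      case (Suc j)
      from l ys consider "(x, y) \<in> wellord" "length xs = length ys'" | "x = y"
        "(xs, ys') \<in> lex wellord"
        by auto
      then show ?thesis
      proof cases
        case 2
        then have "lex_le (take j xs) (take j ys')" by (intro Cons.IH) (simp add: lex_le_def)
        then show ?thesis using 2 Suc ys by (auto simp: lex_le_def)
      qed (use Suc ys in \<open>auto simp: lex_le_def\<close>)
    qed (simp add: lex_le_def)
  qed (simp add: lex_le_def)
qed (auto simp: lex_le_def)

definition sig :: "side \<Rightarrow> 'a exp list \<Rightarrow> 'a exp \<Rightarrow> 'a stream \<Rightarrow> 'a stream set list" where
  "sig s Ms e w = (SOME \<alpha>s. sat_upto s Ms \<alpha>s e w \<and> (\<forall>\<beta>s. sat_upto s Ms \<beta>s e w \<longrightarrow> lex_le \<alpha>s \<beta>s))"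

text \<open>On lists of one length the lexicographic order is well-founded and total, so a minimal
  signature is least.\<close>

lemma sig_least:
  assumes "sat_upto s Ms \<alpha>s e w"
  shows "sat_upto s Ms (sig s Ms e w) e w" "lex_le (sig s Ms e w) \<alpha>s"
proof -
  have "wf (lex (wellord :: 'a stream set rel))" using wf_wellord by blast
  then obtain \<gamma>s where \<gamma>: "sat_upto s Ms \<gamma>s e w"
    "\<And>\<beta>s. (\<beta>s, \<gamma>s) \<in> lex wellord \<Longrightarrow> \<not> sat_upto s Ms \<beta>s e w"
    using wfE_min[of _ \<alpha>s "{\<alpha>s. sat_upto s Ms \<alpha>s e w}"] assms by (metis mem_Collect_eq)
  have "lex_le \<gamma>s \<beta>s" if "sat_upto s Ms \<beta>s e w" for \<beta>s
    using lex_wellord_total[of \<gamma>s \<beta>s] \<gamma> that by (auto simp: sat_upto_def)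
  with \<gamma>(1) have "sat_upto s Ms \<gamma>s e w \<and> (\<forall>\<beta>s. sat_upto s Ms \<beta>s e w \<longrightarrow> lex_le \<gamma>s \<beta>s)" by blast
  then have "sat_upto s Ms (sig s Ms e w) e w \<and> (\<forall>\<beta>s. sat_upto s Ms \<beta>s e w \<longrightarrow> lex_le (sig s Ms e w) \<beta>s)"
    unfolding sig_def by (rule someI)
  then show "sat_upto s Ms (sig s Ms e w) e w" "lex_le (sig s Ms e w) \<alpha>s" using assms by auto
qed

text \<open>The components of the signature up to and including that of \<open>m\<close>.\<close>

definition rank :: "side \<Rightarrow> 'a exp list \<Rightarrow> 'a exp \<Rightarrow> 'a exp \<Rightarrow> 'a stream \<Rightarrow> 'a stream set list" where
  "rank s Ms m e w = take (Suc (length (takeWhile (\<lambda>x. x \<noteq> m) Ms))) (sig s Ms e w)"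

lemma rank_mono:
  "sat_upto s Ms (sig s Ms e w) e' w' \<Longrightarrow> lex_le (rank s Ms m e' w') (rank s Ms m e w)"
  unfolding rank_def by (intro lex_le_take sig_least)

lemma sat_upto_sig: "progress_enum s Ms \<Longrightarrow> closed_exp e \<Longrightarrow> w \<in> sat s e \<Longrightarrow> sat_upto s Ms (sig s Ms e w) e w"
  using sat_imp_sat_upto sig_least(1) by blast

lemma sat_upto_Act: "sat_upto s Ms \<alpha>s (Act (shd w) e) w \<Longrightarrow> sat_upto s Ms \<alpha>s e (stl w)"
  by (auto simp: sat_upto_def split: if_splits)

text \<open>An unfolding will leave the components for \<open>xs\<close> untouched; if
  \<open>m\<close> is listed in \<open>xs\<close>, the components up to that of \<open>m\<close> are
  among them.\<close>

lemma first_occurrence_length: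
  "as @ m # bs = xs @ ys \<Longrightarrow> m \<notin> set as \<Longrightarrow> m \<in> set xs \<Longrightarrow> length as < length xs"
  by (auto simp: append_eq_append_conv2 append_eq_Cons_conv Cons_eq_append_conv)

text \<open>Unfolding \<open>e\<close> can only increase components that come after the place of
  \<open>e\<close> in the size order. A proper subformula \<open>m\<close> of \<open>e\<close> comes
  earlier, so its rank is bounded by the old one; for \<open>m = e\<close> the last component of the
  rank drops.\<close>

lemma rank_unfold_fix:
  assumes wf: "progress_enum s Ms" and e: "closed_exp e" "is_fix e" "w \<in> sat s e"
    "progress_formula s e \<Longrightarrow> e \<in> set Ms"
    and m: "m \<in> set Ms" "m \<sqsubseteq> e"
  shows "lex_le (rank s Ms m (unfold_fix e) w) (rank s Ms m e w)"
    "m = e \<Longrightarrow> (rank s Ms m (unfold_fix e) w, rank s Ms m e w) \<in> lex wellord"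
proof -
  obtain as bs where Ms: "Ms = as @ m # bs" and m_as: "m \<notin> set as"
    using split_list_first[OF m(1)] by blast
  have as: "takeWhile (\<lambda>x. x \<noteq> m) Ms = as"
    unfolding Ms using m_as by (subst takeWhile_append2) auto
  have size_m: "m = e \<or> size m < size e" using m(2) subexps_size by (auto simp: subformula_def)
  have g: "sat_upto s Ms (sig s Ms e w) e w" by (rule sat_upto_sig[OF wf e(1,3)])
  have len: "length (sig s Ms e w) = length Ms" using g by (simp add: sat_upto_def)
  have rank: "rank s Ms m f v = take (Suc (length as)) (sig s Ms f v)" for f v
    by (simp add: rank_def as)
  have "lex_le (rank s Ms m (unfold_fix e) w) (rank s Ms m e w) \<and>
    (m = e \<longrightarrow> (rank s Ms m (unfold_fix e) w, rank s Ms m e w) \<in> lex wellord)"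
  proof (cases "progress_formula s e")
    case True
    then obtain Ms1 Ms2 where Ms': "Ms = Ms1 @ e # Ms2" using e(4) split_list by metis
    define \<alpha>s1 where "\<alpha>s1 = take (length Ms1) (sig s Ms e w)"
    have len1: "length \<alpha>s1 = length Ms1" using len Ms' by (simp add: \<alpha>s1_def)
    obtain \<alpha> \<alpha>s2 where sig: "sig s Ms e w = \<alpha>s1 @ \<alpha> # \<alpha>s2"
      unfolding \<alpha>s1_def using len Ms' id_take_nth_drop[of "length Ms1" "sig s Ms e w"] by auto
    obtain \<beta> \<beta>s2 where \<beta>: "(\<beta>, \<alpha>) \<in> wellord" and "sat_upto s Ms (\<alpha>s1 @ \<beta> # \<beta>s2) (unfold_fix e) w"
      using sat_upto_unfold_progress[of s Ms1 e Ms2 \<alpha>s1 \<alpha> \<alpha>s2 w] wf len1 g sig Ms' by auto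
    then have le: "lex_le (rank s Ms m (unfold_fix e) w) (take (Suc (length as)) (\<alpha>s1 @ \<beta> # \<beta>s2))"
      unfolding rank by (intro lex_le_take sig_least)
    show ?thesis
    proof (cases "m = e")
      case True
      have "as = Ms1" using Ms Ms' True m_as wf append_Cons_eq_iff[of m as bs Ms1 Ms2]
        by (auto simp: progress_enum_def)
      then have "(take (Suc (length as)) (\<alpha>s1 @ \<beta> # \<beta>s2), rank s Ms m e w) \<in> lex wellord"
        using \<beta> len1 by (auto simp: rank sig lex_conv)
      with le have "(rank s Ms m (unfold_fix e) w, rank s Ms m e w) \<in> lex wellord"
        using lex_transI[OF trans_wellord] by (auto simp: lex_le_def dest: transD)
      then show ?thesis by (auto simp: lex_le_def)
    next
      case False
      have "m \<in> set Ms1"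
        using m(1) Ms' wf False size_m by (auto simp: progress_enum_def sorted_append)
      then have k: "length as < length Ms1"
        using first_occurrence_length[OF _ m_as] Ms Ms' by metis
      then have "take (Suc (length as)) (\<alpha>s1 @ \<beta> # \<beta>s2) = rank s Ms m e w"
        using k len1 by (simp add: rank sig)
      with le False show ?thesis by simp
    qed
  next
    case False
    \<comment> \<open>Here \<open>e\<close> is not in the list, so the list is cut by size:
      everything that may occur in \<open>e\<close>, in particular \<open>m\<close>, falls into
      \<open>Ms1\<close>.\<close>
    define Ms1 where "Ms1 = takeWhile (\<lambda>M. size M \<le> size e) Ms"
    define Ms2 where "Ms2 = dropWhile (\<lambda>M. size M \<le> size e) Ms"
    have Ms': "Ms = Ms1 @ Ms2" by (simp add: Ms1_def Ms2_def)
    have large: "size e < size M" if M: "M \<in> set Ms2" for M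
    proof -
      obtain N Ns where N: "Ms2 = N # Ns" using M by (cases Ms2) auto
      then have "\<not> size N \<le> size e" unfolding Ms2_def by (metis dropWhile_eq_Cons_conv)
      moreover have "size N \<le> size M" using wf N M
        by (auto simp: progress_enum_def sorted_append Ms')
      ultimately show ?thesis by simp
    qed
    define \<alpha>s1 where "\<alpha>s1 = take (length Ms1) (sig s Ms e w)"
    have len1: "length \<alpha>s1 = length Ms1" using len Ms' by (simp add: \<alpha>s1_def)
    obtain \<alpha>s2 where sig: "sig s Ms e w = \<alpha>s1 @ \<alpha>s2"
      unfolding \<alpha>s1_def by (metis append_take_drop_id)
    have small: "size M \<le> size e" if "M \<in> set Ms1" for M
      using that by (auto simp: Ms1_def dest: set_takeWhileD)
    have "\<exists>\<beta>s2. sat_upto s (Ms1 @ Ms2) (\<alpha>s1 @ \<beta>s2) (unfold_fix e) w"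
      by (rule sat_upto_unfold_other[where ?\<alpha>s2.0 = \<alpha>s2])
        (use wf[unfolded Ms'] len1 e False g[unfolded sig, unfolded Ms'] small large in auto)
    then obtain \<beta>s2 where "sat_upto s Ms (\<alpha>s1 @ \<beta>s2) (unfold_fix e) w" using Ms' by auto
    then have le: "lex_le (rank s Ms m (unfold_fix e) w) (take (Suc (length as)) (\<alpha>s1 @ \<beta>s2))"
      unfolding rank by (intro lex_le_take sig_least)
    have "m \<noteq> e" using m(1) wf False by (auto simp: progress_enum_def)
    have "m \<in> set Ms1" using m(1) Ms' large size_m by fastforce
    then have k: "length as < length Ms1"
      using first_occurrence_length[OF _ m_as] Ms Ms' by metis
    then have "take (Suc (length as)) (\<alpha>s1 @ \<beta>s2) = rank s Ms m e w"
      using k len1 by (simp add: rank sig)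
    with le \<open>m \<noteq> e\<close> show ?thesis by simp
  qed
  then show "lex_le (rank s Ms m (unfold_fix e) w) (rank s Ms m e w)"
    "m = e \<Longrightarrow> (rank s Ms m (unfold_fix e) w, rank s Ms m e w) \<in> lex wellord" by auto
qed

section \<open>Descent of signatures along traces\<close>

text \<open>\<open>act\<close> says that the trace passes through the principal formula. Only the
  unfolding of a fixed point may raise ranks, namely those of formulas that are not its subformulas;
  every other step must respect all ranks.\<close>

definition descends :: "side \<Rightarrow> 'a exp list \<Rightarrow> bool \<Rightarrow> 'a exp \<Rightarrow> 'a stream \<Rightarrow> 'a exp \<Rightarrow> 'a stream \<Rightarrow> bool" where
  "descends s Ms act e w e' w' \<longleftrightarrow>
    (\<forall>m \<in> set Ms. (act \<and> is_fix e \<longrightarrow> m \<sqsubseteq> e) \<longrightarrow>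
       lex_le (rank s Ms m e' w') (rank s Ms m e w) \<and>
       (act \<and> e = m \<longrightarrow> (rank s Ms m e' w', rank s Ms m e w) \<in> lex wellord))"

text \<open>Well-founded induction on the value \<open>x\<close>: if it occurred after
  \<open>N\<close>, it would persist until the next strict decrease, which leads to a smaller value
  that the induction hypothesis excludes.\<close>

lemma wf_no_infinite_descent:
  fixes f :: "nat \<Rightarrow> 'b"
  assumes "wf R" "\<And>i. N \<le> i \<Longrightarrow> f (Suc i) = f i \<or> (f (Suc i), f i) \<in> R"
    and inf: "\<exists>\<^sub>\<infinity>i. (f (Suc i), f i) \<in> R"
  shows False
proof -
  have "\<forall>i\<ge>N. f i \<noteq> x" for x
    using assms(1)
  proof (induction x rule: wf_induct_rule)
    case (less x)
    show ?case
    proof (intro allI impI notI)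
      fix i assume i: "N \<le> i" "f i = x"
      define j where "j = (LEAST j. i \<le> j \<and> (f (Suc j), f j) \<in> R)"
      have "\<exists>j. i \<le> j \<and> (f (Suc j), f j) \<in> R" using inf by (auto simp: INFM_nat_le)
      then have j: "i \<le> j \<and> (f (Suc j), f j) \<in> R" unfolding j_def by (rule LeastI_ex)
      have "f k = x" if "i \<le> k" "k \<le> j" for k
        using that
      proof (induction k rule: dec_induct)
        case (step k)
        then have "(f (Suc k), f k) \<notin> R" using not_less_Least[of k
          "\<lambda>j. i \<le> j \<and> (f (Suc j), f j) \<in> R"]
            by (auto simp: j_def)
        then show ?case using assms(2)[of k] step i by auto
      qed (use i in simp)
      then have "(f (Suc j), x) \<in> R" using j by force
      moreover have "N \<le> Suc j" using i j by simp
      ultimately show False using less by blast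
    qed
  qed
  then show False by blast
qed

text \<open>\<open>R\<close> does not depend on \<open>i\<close>: if it fails, \<open>P\<close> and
  \<open>Q\<close> hold together only finitely often. Over a finite set of formulas this yields one
  common threshold.\<close>

lemma MOST_infinitely_often:
  assumes "\<exists>\<^sub>\<infinity>i. P i \<and> Q i \<Longrightarrow> R" shows "\<forall>\<^sub>\<infinity>i. P i \<longrightarrow> Q i \<longrightarrow> R"
proof (cases R)
  case False
  with assms have "\<forall>\<^sub>\<infinity>i. \<not> (P i \<and> Q i)" unfolding not_INFM[symmetric] by blast
  then show ?thesis by (rule MOST_mono) simp
qed simp

lemma subexps_refl: "e \<in> subexps e"
  by (cases e) auto

text \<open>From some point on, all formulas principal on the trace contain \<open>m\<close>. From
  there the rank of \<open>m\<close> never grows, yet it drops each of the infinitely many times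
  that \<open>m\<close> is principal.\<close>

lemma no_progress:
  assumes wf: "progress_enum s Ms" and m: "m \<in> set Ms"
    and fin: "finite C" "\<And>i. \<tau> i \<in> C"
    and desc: "\<And>i. descends s Ms (act i) (\<tau> i) (w i) (\<tau> (Suc i)) (w (Suc i))"
    and inf: "\<exists>\<^sub>\<infinity>i. \<tau> i = m \<and> act i"
    and least: "\<And>f. \<exists>\<^sub>\<infinity>i. \<tau> i = f \<and> act i \<Longrightarrow> m \<sqsubseteq> f"
  shows False
proof -
  have ev: "\<forall>\<^sub>\<infinity>i. \<tau> i = f \<longrightarrow> act i \<longrightarrow> m \<sqsubseteq> f" for f
    by (rule MOST_infinitely_often) (rule least)
  have "\<forall>\<^sub>\<infinity>i. \<forall>f\<in>C. \<tau> i = f \<longrightarrow> act i \<longrightarrow> m \<sqsubseteq> f"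
    by (intro eventually_ball_finite fin(1) ballI ev)
  then obtain N where N: "\<And>i. N \<le> i \<Longrightarrow> act i \<Longrightarrow> m \<sqsubseteq> \<tau> i"
    using fin(2) by (auto simp: MOST_nat_le)
  define r where "r i = rank s Ms m (\<tau> i) (w i)" for i
  show False
  proof (rule wf_no_infinite_descent)
    show "wf (lex (wellord :: 'a stream set rel))" using wf_wellord by blast
    show "r (Suc i) = r i \<or> (r (Suc i), r i) \<in> lex wellord" if "N \<le> i" for i
      using desc[of i] m N[OF that] by (auto simp: descends_def lex_le_def r_def)
    have "(r (Suc i), r i) \<in> lex wellord" if "\<tau> i = m \<and> act i" for i
      using desc[of i] m that by (auto simp: descends_def r_def subformula_def subexps_refl)
    then show "\<exists>\<^sub>\<infinity>i. (r (Suc i), r i) \<in> lex wellord"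
      using inf by (auto elim: INFM_mono)
  qed
qed

section \<open>Descent for the single kinds of steps\<close>

lemma descends_sat_upto:
  "sat_upto s Ms (sig s Ms e w) e' w' \<Longrightarrow> \<not> (act \<and> is_fix e) \<Longrightarrow> progress_enum s Ms \<Longrightarrow> descends s Ms act e w e' w'"
  unfolding descends_def progress_enum_def using rank_mono progress_is_fix by blast

lemma descends_refl: "descends s Ms False e w e w"
  by (simp add: descends_def lex_le_def)

lemma descends_unfold_fix:
  assumes "progress_enum s Ms" "closed_exp e" "is_fix e" "w \<in> sat s e"
    "progress_formula s e \<Longrightarrow> e \<in> set Ms"
  shows "descends s Ms True e w (unfold_fix e) w"
  unfolding descends_def using rank_unfold_fix[OF assms] assms(3) by auto

lemma sat_simps:
  "w \<in> sat s (Act a e) \<longleftrightarrow> (if s = LHS then shd w = a \<and> stl w \<in> sat s e else shd w = a \<longrightarrow> stl w \<in> sat s e)"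
  "w \<in> sat s Zero \<longleftrightarrow> s = RHS"
  "w \<in> sat s Top \<longleftrightarrow> s = LHS"
  "w \<in> sat s (Plus e f) \<longleftrightarrow> (if s = LHS then w \<in> sat s e \<or> w \<in> sat s f else w \<in> sat s e \<and> w \<in> sat s f)"
  "w \<in> sat s (Inter e f) \<longleftrightarrow> (if s = LHS then w \<in> sat s e \<and> w \<in> sat s f else w \<in> sat s e \<or> w \<in> sat s f)"
proof -
  have "w \<in> sem \<rho> (Act a e) \<longleftrightarrow> shd w = a \<and> stl w \<in> sem \<rho> e" for \<rho>
    by (auto simp: image_iff) (metis stream.collapse)
  then show "w \<in> sat s (Act a e) \<longleftrightarrow> (if s = LHS then shd w = a \<and> stl w \<in> sat s e else shd w = a \<longrightarrow> stl w \<in> sat s e)"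
    by (cases s) (auto simp: sat_def lang_def simp del: sem.simps)
qed (cases s; auto simp: sat_def lang_def)+

lemma fv_subst: "closed_exp g \<Longrightarrow> fv (subst X g e) = fv e - {X}"
  by (induction e) (auto simp: closed_exp_def)

lemma closed_unfold_fix: "closed_exp e \<Longrightarrow> is_fix e \<Longrightarrow> closed_exp (unfold_fix e)"
  by (cases e) (simp_all add: closed_exp_def fv_subst)

lemma sat_unfold_fix:
  assumes "closed_exp e" "is_fix e"
  shows "sat s (unfold_fix e) = sat s e"
proof -
  have "closed_exp M \<Longrightarrow> is_fix M \<Longrightarrow> gsem s Map.empty \<rho> (unfold_fix M) = gsem s Map.empty \<rho> M" for M ::
    "'a exp" and \<rho>
    using gsem_unfold_fix[of M Map.empty Map.empty s \<rho> \<rho>] gsem_fix_None[of M Map.empty s \<rho>]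
      fixpt_unfold[OF body_sem_mono, of M] by auto
  moreover have "closed_exp (unfold_fix e)" by (rule closed_unfold_fix[OF assms])
  ultimately show ?thesis using assms gsem_empty by metis
qed

lemma descends_Act:
  assumes "progress_enum s Ms" "closed_exp (Act a e)" "w \<in> sat s (Act a e)" "shd w = a"
  shows "descends s Ms False (Act a e) w e (stl w)"
  by (rule descends_sat_upto) (use sat_upto_Act sat_upto_sig[OF assms(1-3)] assms in auto)

text \<open>The component is selected by satisfaction up to the signature of \<open>g\<close>, not
  merely by satisfaction; hence its own signature is no larger.\<close>

lemma descends_choice:
  assumes "progress_enum s Ms" "closed_exp g" "w \<in> sat s g"
    and g: "g = Plus e f \<or> g = Inter e f"
  shows "\<exists>h\<in>{e, f}. w \<in> sat s h \<and> descends s Ms act g w h w"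
proof -
  have "closed_exp e" "closed_exp f" "\<not> is_fix g" using assms(2) g by (auto simp: closed_exp_def)
  moreover have "sat_upto s Ms (sig s Ms g w) g w" by (rule sat_upto_sig[OF assms(1-3)])
  then have "sat_upto s Ms (sig s Ms g w) e w \<or> sat_upto s Ms (sig s Ms g w) f w"
    using g by (auto simp: sat_upto_def split: if_splits)
  ultimately show ?thesis using descends_sat_upto sat_upto_imp_sat assms(1) by blast
qed

lemma descends_both:
  assumes "progress_enum s Ms" "closed_exp g" "w \<in> sat s g"
    and g: "g = Plus e f \<and> s = RHS \<or> g = Inter e f \<and> s = LHS" and "h \<in> {e, f}"
  shows "w \<in> sat s h \<and> descends s Ms act g w h w"
proof -
  have "closed_exp h" "\<not> is_fix g" using assms(2,5) g by (auto simp: closed_exp_def)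
  moreover have "sat_upto s Ms (sig s Ms g w) g w" by (rule sat_upto_sig[OF assms(1-3)])
  then have "sat_upto s Ms (sig s Ms g w) h w"
    using g assms(5) by (auto simp: sat_upto_def split: if_splits)
  ultimately show ?thesis using descends_sat_upto sat_upto_imp_sat assms(1) by blast
qed

section \<open>The Fischer-Ladner closure\<close>

fun components :: "'a exp \<Rightarrow> 'a exp set" where
  "components (Act a e) = {e}"
| "components (Plus e f) = {e, f}"
| "components (Inter e f) = {e, f}"
| "components (Mu X e) = {unfold_fix (Mu X e)}"
| "components (Nu X e) = {unfold_fix (Nu X e)}"
| "components e = {}"

definition fl_closed :: "'a exp set \<Rightarrow> bool" where
  "fl_closed C \<longleftrightarrow> (\<forall>e\<in>C. components e \<subseteq> C)"

text \<open>Simultaneous substitution, again without renaming. It closes a formula under several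
  binders at once.\<close>

primrec psubst :: "(nat \<Rightarrow> 'a exp) \<Rightarrow> 'a exp \<Rightarrow> 'a exp" where
  "psubst \<sigma> (Var X) = \<sigma> X"
| "psubst \<sigma> (Act a e) = Act a (psubst \<sigma> e)"
| "psubst \<sigma> Zero = Zero"
| "psubst \<sigma> (Plus e f) = Plus (psubst \<sigma> e) (psubst \<sigma> f)"
| "psubst \<sigma> (Mu X e) = Mu X (psubst (\<sigma>(X := Var X)) e)"
| "psubst \<sigma> Top = Top"
| "psubst \<sigma> (Inter e f) = Inter (psubst \<sigma> e) (psubst \<sigma> f)"
| "psubst \<sigma> (Nu X e) = Nu X (psubst (\<sigma>(X := Var X)) e)"

lemma psubst_Var: "psubst Var e = e"
  by (induction e) simp_all

text \<open>For \<open>g\<close> the closed instance of a fixed point formula, this shows that its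
  unfolding is again an instance of its body.\<close>

lemma subst_psubst:
  "(\<And>Y. Y \<in> fv e - {X} \<Longrightarrow> X \<notin> fv (\<sigma> Y)) \<Longrightarrow>
    subst X g (psubst (\<sigma>(X := Var X)) e) = psubst (\<sigma>(X := g)) e"
proof (induction e arbitrary: \<sigma>)
  case (Var Y)
  then show ?case by (auto simp: subst_fresh)
next
  case (Mu Y e)
  show ?case
  proof (cases "Y = X")
    case False
    have "subst X g (psubst (\<sigma>(Y := Var Y, X := Var X)) e) = psubst (\<sigma>(Y := Var Y, X := g)) e"
      by (rule Mu.IH) (use Mu.prems False in auto)
    then show ?thesis using False by (simp add: fun_upd_twist[of Y X] flip: fun_upd_def)
  qed (simp flip: fun_upd_def)
next
  case (Nu Y e)
  show ?case
  proof (cases "Y = X")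
    case False
    have "subst X g (psubst (\<sigma>(Y := Var Y, X := Var X)) e) = psubst (\<sigma>(Y := Var Y, X := g)) e"
      by (rule Nu.IH) (use Nu.prems False in auto)
    then show ?thesis using False by (simp add: fun_upd_twist[of Y X] flip: fun_upd_def)
  qed (simp flip: fun_upd_def)
qed auto

lemma fv_psubst: "fv (psubst \<sigma> e) \<subseteq> (\<Union>Y\<in>fv e. fv (\<sigma> Y))"
proof (induction e arbitrary: \<sigma>)
  case (Mu X e)
  have "(\<Union>Y\<in>fv e. fv ((\<sigma>(X := Var X)) Y)) \<subseteq> insert X (\<Union>Y\<in>fv e - {X}. fv (\<sigma> Y))"
    by (auto split: if_splits)
  with Mu[of "\<sigma>(X := Var X)"] show ?case unfolding psubst.simps fv.simps by blast
next
  case (Nu X e)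
  have "(\<Union>Y\<in>fv e. fv ((\<sigma>(X := Var X)) Y)) \<subseteq> insert X (\<Union>Y\<in>fv e - {X}. fv (\<sigma> Y))"
    by (auto split: if_splits)
  with Nu[of "\<sigma>(X := Var X)"] show ?case unfolding psubst.simps fv.simps by blast
next
  case (Plus e f)
  from Plus[of \<sigma>] show ?case by auto
next
  case (Inter e f)
  from Inter[of \<sigma>] show ?case by auto
qed auto

lemma closed_psubst: "(\<And>Y. Y \<in> fv e \<Longrightarrow> closed_exp (\<sigma> Y)) \<Longrightarrow> closed_exp (psubst \<sigma> e)"
  using fv_psubst[of \<sigma> e] by (auto simp: closed_exp_def)

text \<open>Under \<open>\<sigma>\<close>, a variable stands for the closed fixed point formula that binds it. This makes the
  Fischer-Ladner closure structurally recursive, hence finite.\<close>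

primrec closure :: "(nat \<Rightarrow> 'a exp) \<Rightarrow> 'a exp \<Rightarrow> 'a exp set" where
  "closure \<sigma> (Var X) = {}"
| "closure \<sigma> (Act a e) = insert (psubst \<sigma> (Act a e)) (closure \<sigma> e)"
| "closure \<sigma> Zero = {Zero}"
| "closure \<sigma> (Plus e f) = insert (psubst \<sigma> (Plus e f)) (closure \<sigma> e \<union> closure \<sigma> f)"
| "closure \<sigma> (Mu X e) = insert (psubst \<sigma> (Mu X e)) (closure (\<sigma>(X := psubst \<sigma> (Mu X e))) e)"
| "closure \<sigma> Top = {Top}"
| "closure \<sigma> (Inter e f) = insert (psubst \<sigma> (Inter e f)) (closure \<sigma> e \<union> closure \<sigma> f)"
| "closure \<sigma> (Nu X e) = insert (psubst \<sigma> (Nu X e)) (closure (\<sigma>(X := psubst \<sigma> (Nu X e))) e)"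

lemma finite_closure: "finite (closure \<sigma> e)"
  by (induction e arbitrary: \<sigma>) simp_all

lemma psubst_in_closure: "psubst \<sigma> e \<in> closure \<sigma> e \<union> \<sigma> ` fv e"
  by (cases e) auto

text \<open>Taking components leaves the closure only at a variable, by passing to the formula that
  \<sigma> assigns to it. At a binder this formula is in the closure already, so for closed
  \<open>e\<close> nothing escapes.\<close>

lemma components_closure:
  assumes "\<And>Y. Y \<in> fv e \<Longrightarrow> closed_exp (\<sigma> Y)" "g \<in> closure \<sigma> e" "h \<in> components g"
  shows "h \<in> closure \<sigma> e \<union> \<sigma> ` fv e"
  using assms
proof (induction e arbitrary: \<sigma>)
  case (Act a e)
  then show ?case using psubst_in_closure[of \<sigma> e] by auto
next
  case (Plus e f)
  then show ?case using psubst_in_closure[of \<sigma> e] psubst_in_closure[of \<sigma> f] by auto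
next
  case (Inter e f)
  then show ?case using psubst_in_closure[of \<sigma> e] psubst_in_closure[of \<sigma> f] by auto
next
  case (Mu X e)
  define M where "M = psubst \<sigma> (Mu X e)"
  have "closed_exp M" unfolding M_def by (rule closed_psubst[OF Mu.prems(1)])
  have sub: "(\<sigma>(X := M)) ` fv e \<subseteq> insert M (\<sigma> ` fv (Mu X e))" by auto
  show ?case
  proof (cases "g = M")
    case True
    then have "h = subst X M (psubst (\<sigma>(X := Var X)) e)" using Mu.prems(3) by (simp add: M_def)
    also have "\<dots> = psubst (\<sigma>(X := M)) e"
      by (rule subst_psubst) (use Mu.prems(1) in \<open>auto simp: closed_exp_def\<close>)
    finally show ?thesis using psubst_in_closure[of "\<sigma>(X := M)" e] sub
      unfolding closure.simps M_def[symmetric] by blast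
  next
    case False
    have "g \<in> closure (\<sigma>(X := M)) e"
      using Mu.prems(2) False unfolding closure.simps M_def[symmetric] by blast
    moreover have "closed_exp ((\<sigma>(X := M)) Y)" if "Y \<in> fv e" for Y
      using Mu.prems(1) that \<open>closed_exp M\<close> by simp
    ultimately have "h \<in> closure (\<sigma>(X := M)) e \<union> (\<sigma>(X := M)) ` fv e"
      using Mu.IH Mu.prems(3) by blast
    then show ?thesis using sub unfolding closure.simps M_def[symmetric] by blast
  qed
next
  case (Nu X e)
  define M where "M = psubst \<sigma> (Nu X e)"
  have "closed_exp M" unfolding M_def by (rule closed_psubst[OF Nu.prems(1)])
  have sub: "(\<sigma>(X := M)) ` fv e \<subseteq> insert M (\<sigma> ` fv (Nu X e))" by auto
  show ?case
  proof (cases "g = M")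
    case True
    then have "h = subst X M (psubst (\<sigma>(X := Var X)) e)" using Nu.prems(3) by (simp add: M_def)
    also have "\<dots> = psubst (\<sigma>(X := M)) e"
      by (rule subst_psubst) (use Nu.prems(1) in \<open>auto simp: closed_exp_def\<close>)
    finally show ?thesis using psubst_in_closure[of "\<sigma>(X := M)" e] sub
      unfolding closure.simps M_def[symmetric] by blast
  next
    case False
    have "g \<in> closure (\<sigma>(X := M)) e"
      using Nu.prems(2) False unfolding closure.simps M_def[symmetric] by blast
    moreover have "closed_exp ((\<sigma>(X := M)) Y)" if "Y \<in> fv e" for Y
      using Nu.prems(1) that \<open>closed_exp M\<close> by simp
    ultimately have "h \<in> closure (\<sigma>(X := M)) e \<union> (\<sigma>(X := M)) ` fv e"
      using Nu.IH Nu.prems(3) by blast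
    then show ?thesis using sub unfolding closure.simps M_def[symmetric] by blast
  qed
qed auto

section \<open>Guardedness under unfolding and the finite closure\<close>

lemma unguarded_subset_fv: "unguarded_vars e \<subseteq> fv e"
  by (induction e) auto

lemma unguarded_subst: "closed_exp g \<Longrightarrow> unguarded_vars (subst X g e) \<subseteq> unguarded_vars e"
  using unguarded_subset_fv[of g] by (induction e) (auto simp: closed_exp_def)

lemma guarded_subst: "closed_exp g \<Longrightarrow> guarded g \<Longrightarrow> guarded e \<Longrightarrow> guarded (subst X g e)"
  by (induction e) (use unguarded_subst in auto)

lemma components_closed: "closed_exp e \<Longrightarrow> f \<in> components e \<Longrightarrow> closed_exp f"
  using closed_unfold_fix[of e] by (cases e) (auto simp: closed_exp_def)

lemma components_guarded: "closed_exp e \<Longrightarrow> guarded e \<Longrightarrow> f \<in> components e \<Longrightarrow> guarded f"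
  using guarded_subst[of e] by (cases e) auto

lemma fl_closure_exists:
  assumes "finite S" "\<And>e. e \<in> S \<Longrightarrow> closed_exp e \<and> guarded e"
  obtains C where "finite C" "S \<subseteq> C" "fl_closed C" "\<And>e. e \<in> C \<Longrightarrow> closed_exp e \<and> guarded e"
proof
  \<comment> \<open>The filter builds closedness and guardedness into \<open>C\<close>; components
    inherit both, so closure under components survives.\<close>
  define C where "C = {g \<in> (\<Union>e\<in>S. closure Var e). closed_exp g \<and> guarded g}"
  show "finite C" unfolding C_def using assms(1) finite_closure
    by (intro finite_Collect_conjI disjI1) auto
  show "S \<subseteq> C"
    using psubst_in_closure[of Var] assms(2) by (fastforce simp: C_def psubst_Var closed_exp_def)
  show "closed_exp e \<and> guarded e" if "e \<in> C" for e using that by (simp add: C_def)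
  show "fl_closed C"
    unfolding fl_closed_def
  proof (intro ballI subsetI)
    fix g h assume g: "g \<in> C" and h: "h \<in> components g"
    then obtain e where e: "e \<in> S" "g \<in> closure Var e" by (auto simp: C_def)
    then have "fv e = {}" using assms(2) by (simp add: closed_exp_def)
    then have "h \<in> closure Var e" using components_closure[of e Var g h] e h by auto
    then show "h \<in> C" using e g h components_closed components_guarded by (auto simp: C_def)
  qed
qed

lemma progress_enum_exists:
  assumes "finite C" "\<And>e. e \<in> C \<Longrightarrow> closed_exp e"
  obtains Ms where "progress_enum s Ms" "set Ms = {e \<in> C. progress_formula s e}"
proof -
  obtain xs where xs: "set xs = {e \<in> C. progress_formula s e}" "distinct xs"
    using finite_distinct_list[of "{e \<in> C. progress_formula s e}"] assms(1) by auto
  show ?thesis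
    by (rule that[of "sort_key size xs"]) (use xs assms(2) in \<open>auto simp: progress_enum_def\<close>)
qed

section \<open>The least principal formula of a trace\<close>

lemma subexps_trans: "f \<in> subexps e \<Longrightarrow> g \<in> subexps f \<Longrightarrow> g \<in> subexps e"
  by (induction e) auto

lemma in_subexps_subst: "X \<in> fv e \<Longrightarrow> g \<in> subexps (subst X g e)"
  by (induction e) (auto simp: subexps_refl)

text \<open>A node of the instance below which \<open>X\<close> was replaced contains
  \<open>g\<close>; a node below which it was not is a node of \<open>e\<close>; all others lie
  inside a copy of \<open>g\<close>.\<close>

lemma subexps_subst_cases:
  assumes "h \<in> subexps (subst X g e)"
  shows "h \<in> subexps g \<or> h \<in> subexps e \<or> g \<in> subexps h"
proof -
  have "subst X g f = f" if "g \<notin> subexps (subst X g f)" for f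
    using that in_subexps_subst subst_fresh by metis
  with assms show ?thesis
    by (induction e) (auto split: if_splits)
qed

lemma subexps_unfold_fix:
  assumes "is_fix M" "h \<in> subexps (unfold_fix M)" shows "h \<in> subexps M \<or> M \<in> subexps h"
  using assms by (cases M) (auto dest: subexps_subst_cases)

lemma components_subexps: "\<not> is_fix e \<Longrightarrow> f \<in> components e \<Longrightarrow> f \<in> subexps e \<and> size f < size e"
  by (cases e) (auto simp: subexps_refl)

lemma components_fix: "is_fix e \<Longrightarrow> components e = {unfold_fix e}"
  by (cases e) auto

text \<open>A formula of least size among those infinitely often principal works: it recurs, and going
  backwards along the trace it stays a subformula, since an
    unfolding \<open>e(\<sigma>X e)\<close> only adds subformulas
  that contain \<open>\<sigma>X e\<close>.\<close>

lemma least_principal_exists: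
  assumes fin: "finite C" "\<And>i. \<tau> i \<in> C"
    and step: "\<And>i. if act i \<or> is_letter i then \<tau> (Suc i) \<in> components (\<tau> i) else \<tau> (Suc i) = \<tau> i"
    and letter: "\<And>i. is_letter i \<Longrightarrow> \<not> act i \<and> \<not> is_fix (\<tau> i)"
    and inf: "\<exists>\<^sub>\<infinity>i. is_letter i"
  obtains m where "is_fix m" "\<exists>\<^sub>\<infinity>i. \<tau> i = m \<and> act i" "\<And>f. \<exists>\<^sub>\<infinity>i. \<tau> i = f \<and> act i \<Longrightarrow> m \<sqsubseteq> f"
proof -
  \<comment> \<open>Without principal steps sizes never grow, and each of the infinitely many letter
    steps strips a letter.\<close>
  have "\<exists>\<^sub>\<infinity>i. act i"
  proof (rule ccontr)
    assume "\<not> ?thesis"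
    then obtain N where N: "\<And>i. N \<le> i \<Longrightarrow> \<not> act i" by (auto simp: INFM_nat_le)
    show False
    proof (rule wf_no_infinite_descent[of less_than N "\<lambda>i. size (\<tau> i)"])
      have *: "size (\<tau> (Suc i)) < size (\<tau> i)" if "is_letter i" for i
        using step[of i] letter[of i] components_subexps that by auto
      then show "\<exists>\<^sub>\<infinity>i. (size (\<tau> (Suc i)), size (\<tau> i)) \<in> less_than"
        using inf by (auto elim: INFM_mono)
      show "size (\<tau> (Suc i)) = size (\<tau> i) \<or> (size (\<tau> (Suc i)), size (\<tau> i)) \<in> less_than" if "N \<le> i"
        for i
        using step[of i] * N[OF that] by (auto split: if_splits)
    qed simp
  qed
  define I where "I = {f. \<exists>\<^sub>\<infinity>i. \<tau> i = f \<and> act i}"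
  have "\<exists>\<^sub>\<infinity>i. \<exists>f\<in>C. \<tau> i = f \<and> act i"
    using \<open>\<exists>\<^sub>\<infinity>i. act i\<close> fin(2) by (auto elim: INFM_mono)
  then have "I \<noteq> {}" using frequently_bex_finite[OF fin(1), of "\<lambda>i f. \<tau> i = f \<and> act i"]
    unfolding I_def by blast
  define m where "m = arg_min size (\<lambda>f. f \<in> I)"
  have m: "m \<in> I" and m_le: "\<And>f. f \<in> I \<Longrightarrow> size m \<le> size f"
    using arg_min_nat_lemma[of "\<lambda>f. f \<in> I" _ size] \<open>I \<noteq> {}\<close> by (auto simp: m_def)
  have ev: "\<forall>\<^sub>\<infinity>i. \<tau> i = f \<longrightarrow> act i \<longrightarrow> f \<in> I" for f
    by (rule MOST_infinitely_often) (simp add: I_def)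
  have "\<forall>\<^sub>\<infinity>i. \<forall>f\<in>C. \<tau> i = f \<longrightarrow> act i \<longrightarrow> f \<in> I"
    by (intro eventually_ball_finite fin(1) ballI ev)
  then obtain N where N: "\<And>i. N \<le> i \<Longrightarrow> act i \<Longrightarrow> \<tau> i \<in> I"
    using fin(2) by (auto simp: MOST_nat_le)
  have below: "m \<in> subexps (\<tau> i)" if "N \<le> i" for i
  proof -
    obtain j where j: "i \<le> j" "\<tau> j = m" using m by (auto simp: I_def INFM_nat_le)
    show ?thesis using j(1)
    proof (induction i rule: inc_induct)
      case base show ?case using j subexps_refl by metis
    next
      case (step k)
      have k: "N \<le> k" using step.hyps that by simp
      consider (same) "\<tau> (Suc k) = \<tau> k" | (sub) "\<not> is_fix (\<tau> k)" "\<tau> (Suc k) \<in> components (\<tau> k)"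
        | (unf) "act k" "is_fix (\<tau> k)" "\<tau> (Suc k) = unfold_fix (\<tau> k)"
        using assms(3)[of k] letter[of k] components_fix by (fastforce split: if_splits)
      then show ?case
      proof cases
        case same
        then show ?thesis using step.IH by simp
      next
        case sub
        then show ?thesis using step.IH components_subexps subexps_trans by blast
      next
        case unf
        then consider "m \<in> subexps (\<tau> k)" | "\<tau> k \<in> subexps m"
          using subexps_unfold_fix step.IH by metis
        then show ?thesis
        proof cases
          case 2
          \<comment> \<open>\<open>\<tau> k\<close> is principal after \<open>N\<close>, hence
            infinitely often principal, and so no smaller than \<open>m\<close>.\<close>
          have "size m \<le> size (\<tau> k)" using m_le N[OF k unf(1)] by blast
          then have "\<tau> k = m" using subexps_size[OF 2] by auto
          then show ?thesis by (simp add: subexps_refl)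
        qed
      qed
    qed
  qed
  have "m \<sqsubseteq> f" if f: "\<exists>\<^sub>\<infinity>i. \<tau> i = f \<and> act i" for f
  proof -
    obtain i where "N \<le> i" "\<tau> i = f" using f by (auto simp: INFM_nat_le)
    then show ?thesis using below by (auto simp: subformula_def)
  qed
  \<comment> \<open>Otherwise the trace would step from \<open>m\<close> to a smaller formula, which
    nevertheless contains \<open>m\<close> by \<open>below\<close>.\<close>
  moreover have "is_fix m"
  proof (rule ccontr)
    assume "\<not> is_fix m"
    moreover obtain i where i: "N \<le> i" "\<tau> i = m" "act i" using m by (auto simp: I_def INFM_nat_le)
    ultimately have "size (\<tau> (Suc i)) < size m" using step[of i] components_subexps by auto
    moreover have "m \<in> subexps (\<tau> (Suc i))" using below i by simp
    ultimately show False using subexps_size by fastforce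
  qed
  ultimately show ?thesis using that m by (auto simp: I_def)
qed

section \<open>Soundness\<close>

definition refutes :: "'a stream \<Rightarrow> 'a sequent \<Rightarrow> bool" where
  "refutes w S \<longleftrightarrow> (\<forall>s. \<forall>e\<in>formulas s S. w \<in> sat s e)"

lemma all_side: "(\<forall>s. P s) \<longleftrightarrow> P LHS \<and> P RHS"
  by (metis side.exhaust)

lemma refutes_iff: "refutes w (\<Gamma>, \<Delta>) \<longleftrightarrow> (\<forall>e\<in>\<Gamma>. w \<in> sat LHS e) \<and> (\<forall>e\<in>\<Delta>. w \<in> sat RHS e)"
  by (simp add: refutes_def all_side)

definition over :: "'a exp set \<Rightarrow> 'a sequent \<Rightarrow> bool" where
  "over C S \<longleftrightarrow> fst S \<subseteq> C \<and> snd S \<subseteq> C"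

lemma formulas_over: "over C S \<Longrightarrow> e \<in> formulas s S \<Longrightarrow> e \<in> C"
  by (cases s) (auto simp: over_def)

lemma premisses_over:
  assumes "fl_closed C" "over C (conclusion r)" "premisses r p = Some S"
  shows "over C S"
proof -
  have C: "components e \<subseteq> C" if "e \<in> C" for e using assms(1) that by (auto simp: fl_closed_def)
  show ?thesis
  proof (cases r)
    case (P_R G)
    then obtain a where "p = At a" "S = ({}, G a)" using assms(3) by (auto split: pos.splits)
    then show ?thesis using P_R assms(2) C[of "Act a _"] by (auto simp: over_def)
  next
    case (H a \<Gamma> \<Delta>)
    then show ?thesis using assms(2,3) C[of "Act a _"]
      by (auto simp: over_def image_subset_iff split: if_splits)
  next
    case (Plus_L \<Gamma> e f \<Delta>)
    then show ?thesis using assms(2,3) C[of "Plus e f"] by (auto simp: over_def split: if_splits)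
  next
    case (Inter_L \<Gamma> e f \<Delta>)
    then show ?thesis using assms(2,3) C[of "Inter e f"] by (auto simp: over_def split: if_splits)
  next
    case (Mu_L \<Gamma> X e \<Delta>)
    then show ?thesis using assms(2,3) C[of "Mu X e"] by (auto simp: over_def split: if_splits)
  next
    case (Nu_L \<Gamma> X e \<Delta>)
    then show ?thesis using assms(2,3) C[of "Nu X e"] by (auto simp: over_def split: if_splits)
  next
    case (Plus_R \<Gamma> \<Delta> e f)
    then show ?thesis using assms(2,3) C[of "Plus e f"] by (auto simp: over_def split: if_splits)
  next
    case (Inter_R \<Gamma> \<Delta> e f)
    then show ?thesis using assms(2,3) C[of "Inter e f"] by (auto simp: over_def split: if_splits)
  next
    case (Mu_R \<Gamma> \<Delta> X e)
    then show ?thesis using assms(2,3) C[of "Mu X e"] by (auto simp: over_def split: if_splits)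
  next
    case (Nu_R \<Gamma> \<Delta> X e)
    then show ?thesis using assms(2,3) C[of "Nu X e"] by (auto simp: over_def split: if_splits)
  qed (use assms(2,3) in \<open>auto simp: over_def split: if_splits\<close>)
qed

locale signatures =
  fixes C :: "'a exp set" and Ms :: "side \<Rightarrow> 'a exp list"
  assumes finite_C: "finite C" and fl: "fl_closed C" and closed_C: "e \<in> C \<Longrightarrow> closed_exp e"
    and enum_Ms: "progress_enum s (Ms s)" and set_Ms: "set (Ms s) = {e \<in> C. progress_formula s e}"
begin

lemma descends_fix:
  assumes "e \<in> C" "is_fix e" "w \<in> sat s e"
  shows "w \<in> sat s (unfold_fix e)" "descends s (Ms s) True e w (unfold_fix e) w"
proof -
  show "w \<in> sat s (unfold_fix e)" using assms(3) sat_unfold_fix[OF closed_C[OF assms(1)] assms(2), of s] by simp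
  show "descends s (Ms s) True e w (unfold_fix e) w"
  proof (rule descends_unfold_fix[OF enum_Ms closed_C[OF assms(1)] assms(2,3)])
    show "progress_formula s e \<Longrightarrow> e \<in> set (Ms s)" using assms(1) by (simp add: set_Ms)
  qed
qed

lemma refuted_premiss_logical:
  assumes "principal r \<noteq> None" and over: "over C (conclusion r)" and ref: "refutes w (conclusion r)"
  shows "\<exists>p S. premisses r p = Some S \<and> refutes w S \<and>
    (\<forall>s e e'. active r p s e e' \<longrightarrow> descends s (Ms s) True e w e' w)"
proof (cases r)
  case (Plus_L \<Gamma> e f \<Delta>)
  then have "Plus e f \<in> C" "w \<in> sat LHS (Plus e f)" using over ref
    by (auto simp: over_def refutes_iff)
  then obtain h where h: "h \<in> {e, f}" "w \<in> sat LHS h" "descends LHS (Ms LHS) True (Plus e f) w h w"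
    using descends_choice[OF enum_Ms closed_C, where s = LHS and g = "Plus e f" and e = e and f = f
      and act = True] by auto
  show ?thesis
  proof (cases "h = e")
    case True
    then show ?thesis using Plus_L ref h
      by (intro exI[of _ Fst]) (auto simp: active_def refutes_iff)
  next
    case False
    then show ?thesis using Plus_L ref h
      by (intro exI[of _ Snd]) (auto simp: active_def refutes_iff)
  qed
next
  case (Inter_R \<Gamma> \<Delta> e f)
  then have "Inter e f \<in> C" "w \<in> sat RHS (Inter e f)" using over ref
    by (auto simp: over_def refutes_iff)
  then obtain h where h: "h \<in> {e, f}" "w \<in> sat RHS h" "descends RHS (Ms RHS) True (Inter e f) w h w"
    using descends_choice[OF enum_Ms closed_C, where s = RHS and g = "Inter e f" and e = e and f = f
      and act = True] by auto
  show ?thesis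
  proof (cases "h = e")
    case True
    then show ?thesis using Inter_R ref h
      by (intro exI[of _ Fst]) (auto simp: active_def refutes_iff)
  next
    case False
    then show ?thesis using Inter_R ref h
      by (intro exI[of _ Snd]) (auto simp: active_def refutes_iff)
  qed
next
  case (Inter_L \<Gamma> e f \<Delta>)
  then have "Inter e f \<in> C" "w \<in> sat LHS (Inter e f)" using over ref
    by (auto simp: over_def refutes_iff)
  then have "w \<in> sat LHS h \<and> descends LHS (Ms LHS) True (Inter e f) w h w" if "h \<in> {e, f}" for h
    using descends_both[OF enum_Ms closed_C, where s = LHS and g = "Inter e f" and e = e and f = f
      and act = True] that by auto
  then show ?thesis using Inter_L ref by (intro exI[of _ Fst]) (auto simp: active_def refutes_iff)
next
  case (Plus_R \<Gamma> \<Delta> e f)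
  then have "Plus e f \<in> C" "w \<in> sat RHS (Plus e f)" using over ref
    by (auto simp: over_def refutes_iff)
  then have "w \<in> sat RHS h \<and> descends RHS (Ms RHS) True (Plus e f) w h w" if "h \<in> {e, f}" for h
    using descends_both[OF enum_Ms closed_C, where s = RHS and g = "Plus e f" and e = e and f = f
      and act = True] that by auto
  then show ?thesis using Plus_R ref by (intro exI[of _ Fst]) (auto simp: active_def refutes_iff)
next
  case (Mu_L \<Gamma> X e \<Delta>)
  then show ?thesis using descends_fix[of "Mu X e" w LHS] over ref
    by (intro exI[of _ Fst]) (auto simp: active_def refutes_iff over_def)
next
  case (Nu_L \<Gamma> X e \<Delta>)
  then show ?thesis using descends_fix[of "Nu X e" w LHS] over ref
    by (intro exI[of _ Fst]) (auto simp: active_def refutes_iff over_def)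
next
  case (Mu_R \<Gamma> \<Delta> X e)
  then show ?thesis using descends_fix[of "Mu X e" w RHS] over ref
    by (intro exI[of _ Fst]) (auto simp: active_def refutes_iff over_def)
next
  case (Nu_R \<Gamma> \<Delta> X e)
  then show ?thesis using descends_fix[of "Nu X e" w RHS] over ref
    by (intro exI[of _ Fst]) (auto simp: active_def refutes_iff over_def)
next
  case (Zero_L \<Gamma> \<Delta>)
  then show ?thesis using ref by (auto simp: refutes_iff sat_simps)
next
  case (Top_R \<Gamma> \<Delta>)
  then show ?thesis using ref by (auto simp: refutes_iff sat_simps)
qed (use assms in \<open>auto intro!: exI[of _ Fst] simp: active_def refutes_iff\<close>)

lemma refuted_premiss:
  assumes "side_condition r" and over: "over C (conclusion r)" and ref: "refutes w (conclusion r)"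
  shows "\<exists>p S w'. premisses r p = Some S \<and> refutes w' S \<and>
    (\<forall>s e e'. ancestor r p s e e' \<longrightarrow> descends s (Ms s) (active r p s e e') e w e' w')"
proof (cases "principal r = None")
  case False
  then obtain p S where p: "premisses r p = Some S" "refutes w S"
    "\<forall>s e e'. active r p s e e' \<longrightarrow> descends s (Ms s) True e w e' w"
    using refuted_premiss_logical[OF _ over ref] by blast
  have "descends s (Ms s) (active r p s e e') e w e' w" if "ancestor r p s e e'" for s e e'
  proof (cases "active r p s e e'")
    case True
    then show ?thesis using p(3) by simp
  next
    case False
    have "e = e'" using that False \<open>principal r \<noteq> None\<close> by cases auto
    then show ?thesis using False descends_refl by simp
  qed
  then show ?thesis using p by blast
next
  case None: True
  then consider (P_L) a e b f where "r = P_L a e b f" | (H) a \<Gamma> \<Delta> where "r = H a \<Gamma> \<Delta>" | (P_R) G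
    where "r = P_R G"
    by (cases r) auto
  then show ?thesis
  proof cases
    case P_L
    then show ?thesis using ref assms(1) by (auto simp: refutes_iff sat_simps)
  next
    case H
    \<comment> \<open>The left context is nonempty, and its formulas prescribe the first letter of
      \<open>w\<close>.\<close>
    then have a: "shd w = a" using ref assms(1) by (auto simp: refutes_iff sat_simps)
    then have "refutes (stl w) (\<Gamma>, \<Delta>)" using H ref by (auto simp: refutes_iff sat_simps)
    moreover have "descends s (Ms s) (active r Fst s e e') e w e' (stl w)" if
      "ancestor r Fst s e e'" for s e e'
    proof -
      have e: "e = Act a e'" "e' \<in> formulas s (\<Gamma>, \<Delta>)" using that H
        by (cases; auto simp: active_def)+
      then have "Act a e' \<in> formulas s (conclusion r)" using H by (cases s) auto
      then have "Act a e' \<in> C" "w \<in> sat s (Act a e')"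
        using formulas_over[OF over] ref by (auto simp: refutes_def)
      then show ?thesis using descends_Act[OF enum_Ms closed_C] a e None by (simp add: active_def)
    qed
    ultimately show ?thesis using H by (intro exI[of _ Fst]) auto
  next
    case P_R
    \<comment> \<open>The first letter of the word picks the premiss.\<close>
    define a where "a = shd w"
    have "refutes (stl w) ({}, G a)" using P_R ref by (auto simp: refutes_iff sat_simps a_def)
    moreover have "descends s (Ms s) (active r (At a) s e e') e w e' (stl w)" if
      "ancestor r (At a) s e e'" for s e e'
    proof -
      have e: "e = Act a e'" "s = RHS" "e' \<in> G a" using that P_R by (cases; auto simp: active_def)+
      then have "Act a e' \<in> formulas s (conclusion r)" using P_R by auto
      then have "Act a e' \<in> C" "w \<in> sat s (Act a e')"
        using formulas_over[OF over] ref by (auto simp: refutes_def)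
      then show ?thesis using descends_Act[OF enum_Ms closed_C] e None
        by (simp add: active_def a_def)
    qed
    ultimately show ?thesis using P_R by (intro exI[of _ "At a"]) auto
  qed
qed

lemma subtrees_over:
  assumes "preproof P" "over C (end_sequent P)" "t \<in> subtrees P"
  shows "over C (end_sequent t)"
  using assms(3)
proof induction
  case (subtrees_child u p v)
  then have "premisses (step u) p = Some (end_sequent v)"
    using assms(1) unfolding preproof_def by (metis option.simps(9))
  then show ?case using premisses_over[OF fl] subtrees_child(3) by (simp add: end_sequent_def)
qed (rule assms(2))

lemma CRLL_proof_not_refuted:
  assumes P: "CRLL_proof P" and over: "over C (end_sequent P)"
  shows "\<not> refutes w (end_sequent P)"
proof
  assume ref: "refutes w (end_sequent P)"
  have pre: "preproof P" and prog: "progressing P" using P by (auto simp: CRLL_proof_def)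
  define Inv where "Inv = (\<lambda>(t, w). t \<in> subtrees P \<and> refutes w (end_sequent t))"
  \<comment> \<open>Descent is recorded for all traces through the step, since the progressing trace
    is known only after the whole branch.\<close>
  define Q where "Q = (\<lambda>(t, w) p (t', w'). children t p = Some t' \<and>
    (\<forall>s e e'. ancestor (step t) p s e e' \<longrightarrow> descends s (Ms s) (active (step t) p s e e') e w e' w'))"
  have "\<exists>f. \<forall>n. (Inv (f n) \<and> (n = 0 \<longrightarrow> fst (f n) = P)) \<and> (\<exists>p. Q (f n) p (f (Suc n)))"
  proof (rule dependent_nat_choice)
    show "\<exists>x. Inv x \<and> (0 = 0 \<longrightarrow> fst x = P)" using ref by (auto simp: Inv_def intro: subtrees_self)
  next
    fix x and n :: nat assume "Inv x \<and> (n = 0 \<longrightarrow> fst x = P)"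
    then obtain t w where x: "x = (t, w)" "t \<in> subtrees P" "refutes w (conclusion (step t))"
      by (auto simp: Inv_def end_sequent_def)
    obtain p S w' where p: "premisses (step t) p = Some S" "refutes w' S"
      "\<forall>s e e'. ancestor (step t) p s e e' \<longrightarrow> descends s (Ms s) (active (step t) p s e e') e w e' w'"
      using refuted_premiss[OF _ _ x(3)] pre x(2) subtrees_over[OF pre over x(2)]
      unfolding preproof_def end_sequent_def by blast
    obtain t' where t': "children t p = Some t'" "end_sequent t' = S"
      using pre x(2) p(1) unfolding preproof_def by (metis map_option_eq_Some)
    have "Inv (t', w') \<and> Q x p (t', w')"
      using p t' x by (auto simp: Inv_def Q_def intro: subtrees_child)
    then show "\<exists>y. (Inv y \<and> (Suc n = 0 \<longrightarrow> fst y = P)) \<and> (\<exists>p. Q x p y)" by blast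
  qed
  then obtain f where f: "\<And>n. Inv (f n)" "fst (f 0) = P" "\<forall>n. \<exists>p. Q (f n) p (f (Suc n))" by blast
  from f(3) obtain p where p: "\<And>n. Q (f n) (p n) (f (Suc n))" by metis
  define u where "u = fst \<circ> f"
  define v where "v = snd \<circ> f"
  have u: "u n \<in> subtrees P" for n using f(1)[of n] by (auto simp: Inv_def u_def split: prod.splits)
  have ch: "children (u n) (p n) = Some (u (Suc n))"
    and desc: "ancestor (step (u n)) (p n) s e e' \<Longrightarrow>
      descends s (Ms s) (active (step (u n)) (p n) s e e') e (v n) e' (v (Suc n))" for n s e e'
    using p[of n] by (auto simp: Q_def u_def v_def split: prod.splits)
  have "infinite_branch P u p" using ch f(2) by (simp add: infinite_branch_def u_def)
  then obtain s \<tau> where "progressing_trace u p s \<tau>" using prog unfolding progressing_def by blast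
  then obtain m where trace: "infinite_trace u p s \<tau>" and m: "m \<in> inf_principal u p s \<tau>"
    "\<And>f. f \<in> inf_principal u p s \<tau> \<Longrightarrow> m \<sqsubseteq> f" "progress_formula s m"
    unfolding progressing_trace_def by blast
  have \<tau>: "\<tau> i \<in> C" "ancestor (step (u i)) (p i) s (\<tau> i) (\<tau> (Suc i))" for i
    using trace formulas_over[OF subtrees_over[OF pre over u[of i]]]
      by (auto simp: infinite_trace_def)
  obtain i where "\<tau> i = m" using m(1) by (auto simp: inf_principal_def INFM_nat_le)
  then have "m \<in> set (Ms s)" using \<tau>(1) m(3) by (auto simp: set_Ms)
  then show False
    by (rule no_progress[OF enum_Ms _ finite_C \<tau>(1), where w = v and
      act = "\<lambda>i. active (step (u i)) (p i) s (\<tau> i) (\<tau> (Suc i))"])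
      (use desc[OF \<tau>(2)] m in \<open>auto simp: inf_principal_def\<close>)
qed

end

section \<open>Canonical proof search\<close>

text \<open>Bounds the number of logical steps before a letter step. A guarded fixed point outweighs its
  unfolding.\<close>

primrec weight :: "'a exp \<Rightarrow> nat" where
  "weight (Var X) = 1"
| "weight (Act a e) = 1"
| "weight Zero = 1"
| "weight (Plus e f) = Suc (weight e + weight f)"
| "weight (Mu X e) = Suc (weight e)"
| "weight Top = 1"
| "weight (Inter e f) = Suc (weight e + weight f)"
| "weight (Nu X e) = Suc (weight e)"

lemma weight_pos: "0 < weight e"
  by (induction e) auto

text \<open>The occurrences of \<open>X\<close> that are replaced lie below letters, where the
  weight does not look.\<close>

lemma weight_subst: "X \<notin> unguarded_vars e \<Longrightarrow> weight (subst X g e) = weight e"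
  by (induction e) auto

definition seq_weight :: "'a sequent \<Rightarrow> nat" where
  "seq_weight S = sum weight (fst S) + sum weight (snd S)"

text \<open>Auxiliary formulas may merge with the context, which only lowers the sum.\<close>

lemma sum_weight_replace:
  assumes "finite \<Gamma>" "e \<in> \<Gamma>" "finite D" "sum weight D < weight e"
  shows "sum weight (\<Gamma> - {e} \<union> D) < sum weight \<Gamma>"
proof -
  have "sum weight (\<Gamma> - {e} \<union> D) \<le> sum weight (\<Gamma> - {e}) + sum weight D"
    using assms by (simp add: sum_Un_nat)
  also have "\<dots> < sum weight (\<Gamma> - {e}) + weight e" using assms(4) by simp
  also have "\<dots> = sum weight \<Gamma>" using assms(1,2) by (simp add: sum.remove)
  finally show ?thesis .
qed

definition conflict :: "'a sequent \<Rightarrow> bool" where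
  "conflict S \<longleftrightarrow> (\<exists>a b e f. a \<noteq> b \<and> Act a e \<in> fst S \<and> Act b f \<in> fst S)"

text \<open>Decreasing weights force letter steps on every infinite branch. Conflicts persist and
  exclude letter steps, so they occur on no infinite branch. Outside a conflict, weakening removes
  only right formulas whose letter clashes with a left one, so it discards nothing true of the word
  spelled by the branch.\<close>

definition canonical :: "'a sequent \<Rightarrow> 'a inference \<Rightarrow> bool" where
  "canonical S r \<longleftrightarrow> conclusion r = S \<and> side_condition r \<and>
    (\<forall>p S'. premisses r p = Some S' \<longrightarrow> principal r \<noteq> None \<longrightarrow> seq_weight S' < seq_weight S) \<and>
    (\<forall>p S'. premisses r p = Some S' \<longrightarrow> conflict S \<longrightarrow> principal r \<noteq> None \<and> conflict S') \<and>
    (\<forall>\<Gamma> e \<Delta>. r = W_L \<Gamma> e \<Delta> \<longrightarrow> conflict S) \<and>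
    (\<forall>\<Gamma> \<Delta> e. r = W_R \<Gamma> \<Delta> e \<longrightarrow> conflict S \<or> (\<exists>a b f g. e = Act b f \<and> Act a g \<in> fst S \<and> a \<noteq> b))"

lemma canonicalD:
  assumes "canonical S r"
  shows "conclusion r = S" "side_condition r"
    "premisses r p = Some S' \<Longrightarrow> principal r \<noteq> None \<Longrightarrow> seq_weight S' < seq_weight S"
    "premisses r p = Some S' \<Longrightarrow> conflict S \<Longrightarrow> principal r \<noteq> None"
    "premisses r p = Some S' \<Longrightarrow> conflict S \<Longrightarrow> conflict S'"
    "r = W_L \<Gamma> e \<Delta> \<Longrightarrow> conflict S"
    "r = W_R \<Gamma> \<Delta> e \<Longrightarrow> \<not> conflict S \<Longrightarrow> \<exists>a b f g. e = Act b f \<and> Act a g \<in> fst S \<and> a \<noteq> b"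
  using assms unfolding canonical_def by blast+

lemma canonical_conflict:
  assumes fin: "finite \<Gamma>" "finite \<Delta>" and "conflict (\<Gamma>, \<Delta>)"
  shows "\<exists>r. canonical (\<Gamma>, \<Delta>) r"
proof -
  obtain a b e f where ab: "a \<noteq> b" "Act a e \<in> \<Gamma>" "Act b f \<in> \<Gamma>" using assms(3)
    by (auto simp: conflict_def)
  consider (R) g where "g \<in> \<Delta>" | (L) g where "g \<in> \<Gamma>" "g \<noteq> Act a e" "g \<noteq> Act b f"
    | (P) "\<Gamma> = {Act a e, Act b f}" "\<Delta> = {}" using ab by blast
  then show ?thesis
  proof cases
    case R
    then have "sum weight (\<Delta> - {g}) < sum weight \<Delta>"
      using sum_weight_replace[OF fin(2) R, of "{}"] weight_pos[of g] by simp
    then have "canonical (\<Gamma>, \<Delta>) (W_R \<Gamma> (\<Delta> - {g}) g)"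
      using assms(3) R by (auto simp: canonical_def conflict_def seq_weight_def split: if_splits)
    then show ?thesis by blast
  next
    case L
    then have "sum weight (\<Gamma> - {g}) < sum weight \<Gamma>"
      using sum_weight_replace[OF fin(1) L(1), of "{}"] weight_pos[of g] by simp
    \<comment> \<open>The clashing pair itself is never weakened away.\<close>
    moreover have "conflict (\<Gamma> - {g}, \<Delta>)" unfolding conflict_def using ab L
      by (metis Diff_iff fst_conv singletonD)
    ultimately have "canonical (\<Gamma>, \<Delta>) (W_L (\<Gamma> - {g}) g \<Delta>)"
      using assms(3) L by (auto simp: canonical_def seq_weight_def split: if_splits)
    then show ?thesis by blast
  next
    case P
    then have "canonical (\<Gamma>, \<Delta>) (P_L a e b f)" using ab by (auto simp: canonical_def)
    then show ?thesis by blast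
  qed
qed

text \<open>The context is taken without the principal formula \<open>g\<close>. The rules on sets
  would also allow keeping it, but then the weight need not drop.\<close>

lemma canonical_logical_L:
  assumes fin: "finite \<Gamma>" "finite \<Delta>" and "\<not> conflict (\<Gamma>, \<Delta>)"
    and g: "g \<in> \<Gamma>" "closed_exp g" "guarded g" "\<nexists>a e. g = Act a e"
  shows "\<exists>r. canonical (\<Gamma>, \<Delta>) r"
proof -
  have replace: "sum weight (\<Gamma> - {g} \<union> D) < sum weight \<Gamma>" if "finite D" "sum weight D < weight g"
    for D
    by (rule sum_weight_replace[OF fin(1) g(1) that])
  have ins: "insert g (\<Gamma> - {g}) = \<Gamma>" using g(1) by auto
  show ?thesis
  proof (cases g)
    case Zero
    then have "canonical (\<Gamma>, \<Delta>) (Zero_L (\<Gamma> - {g}) \<Delta>)" using ins by (simp add: canonical_def)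
    then show ?thesis by blast
  next
    case Top
    then have "canonical (\<Gamma>, \<Delta>) (Top_L (\<Gamma> - {g}) \<Delta>)"
      using ins replace[of "{}"] assms(3)
        by (auto simp: canonical_def seq_weight_def split: if_splits)
    then show ?thesis by blast
  next
    case (Plus e f)
    then have "canonical (\<Gamma>, \<Delta>) (Plus_L (\<Gamma> - {g}) e f \<Delta>)"
      using ins replace[of "{e}"] replace[of "{f}"] assms(3)
      by (auto simp: canonical_def seq_weight_def split: if_splits)
    then show ?thesis by blast
  next
    case (Inter e f)
    have "sum weight {e, f} \<le> weight e + weight f" by (cases "e = f") auto
    with Inter have "canonical (\<Gamma>, \<Delta>) (Inter_L (\<Gamma> - {g}) e f \<Delta>)"
      using ins replace[of "{e, f}"] assms(3)
      by (auto simp: canonical_def seq_weight_def split: if_splits)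
    then show ?thesis by blast
  next
    case (Mu X e)
    then have "canonical (\<Gamma>, \<Delta>) (Mu_L (\<Gamma> - {g}) X e \<Delta>)"
      using ins replace[of "{subst X g e}"] assms(3) g(3)
      by (auto simp: canonical_def seq_weight_def weight_subst split: if_splits)
    then show ?thesis by blast
  next
    case (Nu X e)
    then have "canonical (\<Gamma>, \<Delta>) (Nu_L (\<Gamma> - {g}) X e \<Delta>)"
      using ins replace[of "{subst X g e}"] assms(3) g(3)
      by (auto simp: canonical_def seq_weight_def weight_subst split: if_splits)
    then show ?thesis by blast
  qed (use g in \<open>auto simp: closed_exp_def\<close>)
qed

lemma canonical_logical_R:
  assumes fin: "finite \<Gamma>" "finite \<Delta>" and "\<not> conflict (\<Gamma>, \<Delta>)"
    and g: "g \<in> \<Delta>" "closed_exp g" "guarded g" "\<nexists>a e. g = Act a e"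
  shows "\<exists>r. canonical (\<Gamma>, \<Delta>) r"
proof -
  have replace: "sum weight (\<Delta> - {g} \<union> D) < sum weight \<Delta>" if "finite D" "sum weight D < weight g"
    for D
    by (rule sum_weight_replace[OF fin(2) g(1) that])
  have ins: "insert g (\<Delta> - {g}) = \<Delta>" using g(1) by auto
  show ?thesis
  proof (cases g)
    case Zero
    then have "canonical (\<Gamma>, \<Delta>) (Zero_R \<Gamma> (\<Delta> - {g}))"
      using ins replace[of "{}"] assms(3)
        by (auto simp: canonical_def seq_weight_def split: if_splits)
    then show ?thesis by blast
  next
    case Top
    then have "canonical (\<Gamma>, \<Delta>) (Top_R \<Gamma> (\<Delta> - {g}))" using ins by (simp add: canonical_def)
    then show ?thesis by blast
  next
    case (Inter e f)
    then have "canonical (\<Gamma>, \<Delta>) (Inter_R \<Gamma> (\<Delta> - {g}) e f)"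
      using ins replace[of "{e}"] replace[of "{f}"] assms(3)
      by (auto simp: canonical_def seq_weight_def split: if_splits)
    then show ?thesis by blast
  next
    case (Plus e f)
    have "sum weight {e, f} \<le> weight e + weight f" by (cases "e = f") auto
    with Plus have "canonical (\<Gamma>, \<Delta>) (Plus_R \<Gamma> (\<Delta> - {g}) e f)"
      using ins replace[of "{e, f}"] assms(3)
      by (auto simp: canonical_def seq_weight_def split: if_splits)
    then show ?thesis by blast
  next
    case (Mu X e)
    then have "canonical (\<Gamma>, \<Delta>) (Mu_R \<Gamma> (\<Delta> - {g}) X e)"
      using ins replace[of "{subst X g e}"] assms(3) g(3)
      by (auto simp: canonical_def seq_weight_def weight_subst split: if_splits)
    then show ?thesis by blast
  next
    case (Nu X e)
    then have "canonical (\<Gamma>, \<Delta>) (Nu_R \<Gamma> (\<Delta> - {g}) X e)"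
      using ins replace[of "{subst X g e}"] assms(3) g(3)
      by (auto simp: canonical_def seq_weight_def weight_subst split: if_splits)
    then show ?thesis by blast
  qed (use g in \<open>auto simp: closed_exp_def\<close>)
qed

lemma canonical_letter:
  assumes fin: "finite \<Gamma>" "finite \<Delta>" and nc: "\<not> conflict (\<Gamma>, \<Delta>)"
    and acts: "\<And>g. g \<in> \<Gamma> \<union> \<Delta> \<Longrightarrow> \<exists>a e. g = Act a e"
  shows "\<exists>r. canonical (\<Gamma>, \<Delta>) r"
proof (cases "\<Gamma> = {}")
  case True
  have "(\<Union>a. Act a ` {e. Act a e \<in> \<Delta>}) = \<Delta>" using acts by fastforce
  then have "canonical (\<Gamma>, \<Delta>) (P_R (\<lambda>a. {e. Act a e \<in> \<Delta>}))"
    using True nc by (auto simp: canonical_def)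
  then show ?thesis by blast
next
  case False
  then obtain a e where a: "Act a e \<in> \<Gamma>" using acts by blast
  show ?thesis
  proof (cases "\<exists>b f. b \<noteq> a \<and> Act b f \<in> \<Delta>")
    case True
    then obtain b f where b: "b \<noteq> a" "Act b f \<in> \<Delta>" by blast
    have "sum weight (\<Delta> - {Act b f}) < sum weight \<Delta>"
      using sum_weight_replace[OF fin(2) b(2), of "{}"] by simp
    then have "canonical (\<Gamma>, \<Delta>) (W_R \<Gamma> (\<Delta> - {Act b f}) (Act b f))"
      using nc a b by (auto simp: canonical_def seq_weight_def split: if_splits)
    then show ?thesis by blast
  next
    case False
    have "Act a ` {e. Act a e \<in> \<Gamma>} = \<Gamma>" using acts nc a by (fastforce simp: conflict_def)
    moreover have "Act a ` {e. Act a e \<in> \<Delta>} = \<Delta>" using acts False by fastforce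
    ultimately have "canonical (\<Gamma>, \<Delta>) (H a {e. Act a e \<in> \<Gamma>} {e. Act a e \<in> \<Delta>})"
      using nc a by (auto simp: canonical_def)
    then show ?thesis by blast
  qed
qed

lemma canonical_exists:
  assumes "finite (fst S)" "finite (snd S)" "\<And>e. e \<in> fst S \<union> snd S \<Longrightarrow> closed_exp e \<and> guarded e"
  shows "\<exists>r. canonical S r"
proof -
  obtain \<Gamma> \<Delta> where S: "S = (\<Gamma>, \<Delta>)" by fastforce
  consider "conflict S" | g where "\<not> conflict S" "g \<in> \<Gamma>" "\<nexists>a e. g = Act a e"
    | g where "\<not> conflict S" "g \<in> \<Delta>" "\<nexists>a e. g = Act a e"
    | "\<not> conflict S" "\<And>g. g \<in> \<Gamma> \<union> \<Delta> \<Longrightarrow> \<exists>a e. g = Act a e" by blast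
  then show ?thesis
  proof cases
    case 1 then show ?thesis using canonical_conflict assms S by simp
  next
    case 2 then show ?thesis using canonical_logical_L assms S by (metis UnCI fst_conv snd_conv)
  next
    case 3 then show ?thesis using canonical_logical_R assms S by (metis UnCI fst_conv snd_conv)
  next
    case 4 then show ?thesis using canonical_letter assms S by (metis fst_conv snd_conv)
  qed
qed

section \<open>The search tree and the words spelled by branches\<close>

definition rule_for :: "'a sequent \<Rightarrow> 'a inference" where
  "rule_for S = (SOME r. canonical S r)"

text \<open>The tree is a function of its sequent alone, which makes it regular over a finite set of
  formulas.\<close>

primcorec proof_search :: "'a sequent \<Rightarrow> 'a tree" where
  "proof_search S = Node (rule_for S) (\<lambda>p. map_option proof_search (premisses (rule_for S) p))"

primrec opp :: "side \<Rightarrow> side" where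
  "opp LHS = RHS"
| "opp RHS = LHS"

lemma infinite_word:
  fixes l :: "nat \<Rightarrow> 'a"
  assumes "\<exists>\<^sub>\<infinity>i. L i"
  obtains W where "\<And>i. \<not> L i \<Longrightarrow> W (Suc i) = W i" "\<And>i. L i \<Longrightarrow> W i = l i ## W (Suc i)"
proof -
  define nxt where "nxt i = (LEAST j. i \<le> j \<and> L j)" for i
  \<comment> \<open>\<open>nxt i\<close> is the first letter step from \<open>i\<close> on;
    iterating \<open>Suc \<circ> nxt\<close> visits these steps in order, and \<open>W i\<close>
    collects their letters.\<close>
  define W where "W i = smap (l \<circ> nxt) (siterate (Suc \<circ> nxt) i)" for i
  have unfold: "W i = l (nxt i) ## W (Suc (nxt i))" for i
    unfolding W_def by (subst siterate.ctr) simp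
  have L: "nxt i = i" if "L i" for i
    unfolding nxt_def by (rule Least_equality) (use that in auto)
  have nL: "nxt i = nxt (Suc i)" if "\<not> L i" for i
  proof -
    have "i \<le> j \<and> L j \<longleftrightarrow> Suc i \<le> j \<and> L j" for j using that
      by (metis Suc_leD le_antisym not_less_eq_eq)
    then show ?thesis by (simp add: nxt_def)
  qed
  show ?thesis by (rule that[of W]) (metis unfold L nL)+
qed

lemma principal_Act:
  assumes "principal r = Some (s, Act a e)"
  shows "(\<exists>\<Gamma> \<Delta>. r = W_L \<Gamma> (Act a e) \<Delta>) \<or> (\<exists>\<Gamma> \<Delta>. r = W_R \<Gamma> \<Delta> (Act a e))"
  using assms by (cases r) auto

lemma side_formula_persists:
  assumes "principal r \<noteq> None" "principal r \<noteq> Some (s, e)" "premisses r p = Some S"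
    "e \<in> formulas s (conclusion r)"
  shows "e \<in> formulas s S"
  using assms by (cases r; cases s) (auto split: if_splits)

section \<open>Completeness\<close>

context signatures
begin

lemma trace_step_logical:
  assumes "principal r = Some (s, e)" "premisses r p = Some S" "over C (conclusion r)"
    and w: "w \<in> sat (opp s) e"
    and nw: "\<nexists>\<Gamma> f \<Delta>. r = W_L \<Gamma> f \<Delta>" "\<nexists>\<Gamma> \<Delta> f. r = W_R \<Gamma> \<Delta> f"
  shows "\<exists>e'. e' \<in> formulas s S \<and> w \<in> sat (opp s) e' \<and> active r p s e e' \<and> e' \<in> components e \<and>
    descends (opp s) (Ms (opp s)) True e w e' w"
proof -
  have e: "e \<in> C" using assms(1,3) by (cases r) (auto simp: over_def)
  show ?thesis
  proof (cases r)
    case (Plus_L \<Gamma> f g \<Delta>)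
    then have *: "s = LHS" "e = Plus f g" using assms(1) by auto
    have "w \<in> sat RHS h \<and> descends RHS (Ms RHS) True e w h w" if "h \<in> {f, g}" for h
      using descends_both[OF enum_Ms closed_C[OF e], of w RHS f g h] w * that by auto
    then show ?thesis using Plus_L * assms(2)
      by (intro exI[of _ "if p = Fst then f else g"]) (auto simp: active_def split: if_splits)
  next
    case (Inter_R \<Gamma> \<Delta> f g)
    then have *: "s = RHS" "e = Inter f g" using assms(1) by auto
    have "w \<in> sat LHS h \<and> descends LHS (Ms LHS) True e w h w" if "h \<in> {f, g}" for h
      using descends_both[OF enum_Ms closed_C[OF e], of w LHS f g h] w * that by auto
    then show ?thesis using Inter_R * assms(2)
      by (intro exI[of _ "if p = Fst then f else g"]) (auto simp: active_def split: if_splits)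
  next
    case (Inter_L \<Gamma> f g \<Delta>)
    then have *: "s = LHS" "e = Inter f g" using assms(1) by auto
    obtain h where "h \<in> {f, g}" "w \<in> sat RHS h" "descends RHS (Ms RHS) True e w h w"
      using descends_choice[OF enum_Ms closed_C[OF e], of w RHS f g True] w * by auto
    then show ?thesis using Inter_L * assms(2)
      by (intro exI[of _ h]) (auto simp: active_def split: if_splits)
  next
    case (Plus_R \<Gamma> \<Delta> f g)
    then have *: "s = RHS" "e = Plus f g" using assms(1) by auto
    obtain h where "h \<in> {f, g}" "w \<in> sat LHS h" "descends LHS (Ms LHS) True e w h w"
      using descends_choice[OF enum_Ms closed_C[OF e], of w LHS f g True] w * by auto
    then show ?thesis using Plus_R * assms(2)
      by (intro exI[of _ h]) (auto simp: active_def split: if_splits)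
  next
    case (Mu_L \<Gamma> X f \<Delta>)
    then show ?thesis using descends_fix[OF e _ w] assms(1,2)
      by (intro exI[of _ "unfold_fix e"]) (auto simp: active_def split: if_splits)
  next
    case (Nu_L \<Gamma> X f \<Delta>)
    then show ?thesis using descends_fix[OF e _ w] assms(1,2)
      by (intro exI[of _ "unfold_fix e"]) (auto simp: active_def split: if_splits)
  next
    case (Mu_R \<Gamma> \<Delta> X f)
    then show ?thesis using descends_fix[OF e _ w] assms(1,2)
      by (intro exI[of _ "unfold_fix e"]) (auto simp: active_def split: if_splits)
  next
    case (Nu_R \<Gamma> \<Delta> X f)
    then show ?thesis using descends_fix[OF e _ w] assms(1,2)
      by (intro exI[of _ "unfold_fix e"]) (auto simp: active_def split: if_splits)
  qed (use assms in \<open>auto simp: sat_simps\<close>)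
qed

end

locale guarded_signatures = signatures +
  assumes guarded_C: "e \<in> C \<Longrightarrow> guarded e"
begin

section \<open>The search tree is a regular progressing preproof\<close>

lemma rule_for_canonical: "over C S \<Longrightarrow> canonical S (rule_for S)"
  unfolding rule_for_def
  by (rule someI_ex, rule canonical_exists)
    (auto simp: over_def intro: finite_subset[OF _ finite_C] closed_C guarded_C)

lemma end_sequent_proof_search: "over C S \<Longrightarrow> end_sequent (proof_search S) = S"
  using rule_for_canonical by (simp add: end_sequent_def canonical_def)

lemma premisses_rule_for_over:
  "over C S \<Longrightarrow> premisses (rule_for S) p = Some S' \<Longrightarrow> over C S'"
  using premisses_over[OF fl, of "rule_for S"] rule_for_canonical[of S] by (simp add: canonical_def)

lemma subtrees_proof_search:
  assumes "over C S" "t \<in> subtrees (proof_search S)"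
  shows "\<exists>S'. over C S' \<and> t = proof_search S'"
  using assms(2)
proof induction
  case (subtrees_child u p v)
  then obtain S' where S': "over C S'" "u = proof_search S'" by blast
  then obtain S'' where "premisses (rule_for S') p = Some S''" "v = proof_search S''"
    using subtrees_child.hyps by (auto simp del: split_paired_Ex)
  then show ?case using premisses_rule_for_over[OF S'(1)] by blast
qed (use assms(1) in blast)

lemma preproof_proof_search:
  assumes "over C S" shows "preproof (proof_search S)"
  unfolding preproof_def
proof (intro ballI conjI allI)
  fix u p assume "u \<in> subtrees (proof_search S)"
  then obtain S' where S': "over C S'" "u = proof_search S'" using subtrees_proof_search[OF assms]
    by blast
  show "is_sequent (end_sequent u)"
    using S' end_sequent_proof_search closed_C finite_subset[OF _ finite_C]
    by (auto simp: is_sequent_def over_def)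
  show "side_condition (step u)" using rule_for_canonical S' by (simp add: canonical_def)
  show "map_option end_sequent (children u p) = premisses (step u) p"
    using end_sequent_proof_search[OF premisses_rule_for_over[OF S'(1)]] S'(2)
    by (cases "premisses (rule_for S') p") auto
qed

lemma regular_proof_search:
  assumes "over C S" shows "regular (proof_search S)"
proof -
  have "subtrees (proof_search S) \<subseteq> proof_search ` (Pow C \<times> Pow C)"
    using subtrees_proof_search[OF assms] by (fastforce simp: over_def mem_Times_iff)
  then show ?thesis unfolding regular_def using finite_C
    by (meson finite_Pow_iff finite_SigmaI finite_imageI finite_subset)
qed

lemma progressing_proof_search:
  assumes over: "over C S0" and valid: "\<And>w. \<not> refutes w S0"
  shows "progressing (proof_search S0)"
  unfolding progressing_def
proof (intro allI impI)
  fix u p assume branch: "infinite_branch (proof_search S0) u p"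
  define S where "S i = end_sequent (u i)" for i
  define r where "r i = step (u i)" for i
  have u_sub: "u i \<in> subtrees (proof_search S0)" for i
  proof (induction i)
    case 0 show ?case using branch by (auto simp: infinite_branch_def intro: subtrees_self)
  next
    case (Suc i) then show ?case using branch
      by (auto simp: infinite_branch_def intro: subtrees_child)
  qed
  have u: "over C (S i)" "u i = proof_search (S i)" for i
    using subtrees_proof_search[OF assms(1) u_sub[of i]] end_sequent_proof_search
      by (auto simp: S_def)
  have prem: "premisses (r i) (p i) = Some (S (Suc i))" for i
    using preproof_proof_search[OF over] u_sub[of i] branch
    unfolding preproof_def infinite_branch_def r_def S_def by (metis option.simps(9))
  have r: "canonical (S i) (r i)" for i
    using rule_for_canonical[OF u(1)[of i]] u(2)[of i] unfolding r_def
      by (metis proof_search.sel(1))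
  then have concl: "conclusion (r i) = S i" for i by (simp add: canonical_def)
  define L where "L i \<longleftrightarrow> principal (r i) = None" for i
  \<comment> \<open>All other steps lower the weight of the sequent, so letter steps must
    recur.\<close>
  have inf: "\<exists>\<^sub>\<infinity>i. L i"
  proof (rule ccontr)
    assume "\<not> ?thesis"
    then obtain N where N: "\<And>i. N \<le> i \<Longrightarrow> \<not> L i" by (auto simp: INFM_nat_le)
    then have desc: "(seq_weight (S (Suc i)), seq_weight (S i)) \<in> less_than" if "N \<le> i" for i
      using canonicalD(3)[OF r prem] N[OF that] by (simp add: L_def)
    have "\<exists>\<^sub>\<infinity>i. (seq_weight (S (Suc i)), seq_weight (S i)) \<in> less_than"
      unfolding INFM_nat_le
    proof
      fix k show "\<exists>n\<ge>k. (seq_weight (S (Suc n)), seq_weight (S n)) \<in> less_than"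
        using desc[of "max k N"] by (intro exI[of _ "max k N"]) simp
    qed
    then show False
      using wf_no_infinite_descent[of less_than N "\<lambda>i. seq_weight (S i)"] desc by blast
  qed
  \<comment> \<open>A conflict would persist up to the next letter step, where it is
    excluded.\<close>
  have no_conflict: "\<not> conflict (S i)" for i
  proof
    assume i: "conflict (S i)"
    have "conflict (S j)" if "i \<le> j" for j
      using that by (induction rule: dec_induct) (use i canonicalD(5)[OF r prem] in auto)
    moreover obtain j where "i \<le> j" "L j" using inf by (auto simp: INFM_nat_le)
    ultimately show False using canonicalD(4)[OF r prem] unfolding L_def by blast
  qed
  \<comment> \<open>The letter consumed at a letter step; at other steps the value is irrelevant,
    because \<open>W\<close> does not change there.\<close>
  define l where "l i = (case r i of H a _ _ \<Rightarrow> a | _ \<Rightarrow> (case p i of At a \<Rightarrow> a))" for i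
  obtain W where W: "\<And>i. \<not> L i \<Longrightarrow> W (Suc i) = W i" "\<And>i. L i \<Longrightarrow> W i = l i ## W (Suc i)"
    using infinite_word[OF inf] by blast
  have letter: "(\<exists>a \<Gamma> \<Delta>. r i = H a \<Gamma> \<Delta> \<and> p i = Fst \<and> l i = a) \<or> (\<exists>a G. r i = P_R G \<and> p i = At a \<and> l i = a)" if "L i" for i
    using that prem[of i] by (cases "r i") (auto simp: L_def l_def split: if_splits pos.splits)
  \<comment> \<open>Without conflict, \<open>Act a e\<close> is neither decomposed nor weakened
    away, so it survives to the next letter step, which must then be an instance of
    \<open>H a\<close>.\<close>
  have head: "shd (W i) = a" if "Act a e \<in> fst (S i)" for i a e
  proof -
    obtain j where "i \<le> j" "L j" using inf by (auto simp: INFM_nat_le)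
    then show ?thesis using that
    proof (induction i rule: inc_induct)
      case base
      then show ?case using letter[of j] concl[of j, symmetric] W(2)[of j] by auto
    next
      case (step k)
      show ?case
      proof (cases "L k")
        case True
        then show ?thesis using step.prems letter[of k] concl[of k, symmetric] W(2)[of k] by auto
      next
        case False
        have "principal (r k) \<noteq> Some (LHS, Act a e)"
          using principal_Act[of "r k" LHS a e] canonicalD(6)[OF r] no_conflict[of k] by fastforce
        then have "Act a e \<in> fst (S (Suc k))"
          using side_formula_persists[of "r k" LHS "Act a e"
            "p k"] False prem[of k] concl[of k] step.prems
          by (auto simp: L_def)
        then show ?thesis using step W(1)[OF False] by simp
      qed
    qed
  qed
  \<comment> \<open>Validity enters here: \<open>W 0\<close> does not refute the end sequent, so
    some formula in it is satisfied on the opposite side.\<close>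
  obtain s e0 where e0: "e0 \<in> formulas s (S 0)" "W 0 \<in> sat (opp s) e0"
  proof -
    have "S 0 = S0" using branch end_sequent_proof_search[OF over]
      by (simp add: S_def infinite_branch_def)
    then obtain s e where "e \<in> formulas s (S 0)" "W 0 \<notin> sat s e" using valid[of "W 0"]
      by (auto simp: refutes_def)
    then show ?thesis using that[of e s] by (cases s) (auto simp: sat_def)
  qed
  define Q where "Q i e e' \<longleftrightarrow> ancestor (r i) (p i) s e e' \<and>
    descends (opp s) (Ms (opp s)) (active (r i) (p i) s e e') e (W i) e' (W (Suc i)) \<and>
    (if active (r i) (p i) s e e' \<or> L i then e' \<in> components e else e' = e) \<and> (L i \<longrightarrow> \<not> is_fix e)" for i e e'
  define Inv where "Inv i e \<longleftrightarrow> e \<in> formulas s (S i) \<and> W i \<in> sat (opp s) e" for i e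
  have next_formula: "\<exists>e'. Inv (Suc i) e' \<and> Q i e e'" if "Inv i e" for i e
  proof -
    have e: "e \<in> formulas s (S i)" "W i \<in> sat (opp s) e" using that by (auto simp: Inv_def)
    then have eC: "e \<in> C" using formulas_over u(1) by blast
    show ?thesis
    proof (cases "L i")
      case True
      have "\<exists>e'. e = Act (l i) e' \<and> e' \<in> formulas s (S (Suc i)) \<and> ancestor (r i) (p i) s e e'"
        using letter[OF True]
      proof (elim disjE exE conjE)
        fix a \<Gamma> \<Delta> assume H: "r i = H a \<Gamma> \<Delta>" "p i = Fst" "l i = a"
        then have S: "S i = (Act a ` \<Gamma>, Act a ` \<Delta>)" "S (Suc i) = (\<Gamma>, \<Delta>)"
          using concl[of i] prem[of i] by auto
        then obtain e' where "e = Act a e'" "e' \<in> formulas s (\<Gamma>, \<Delta>)" using e(1) by (cases s) auto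
        then show ?thesis using H S ancestor.anc_H by auto
      next
        fix a G assume P: "r i = P_R G" "p i = At a" "l i = a"
        then have S: "S i = ({}, \<Union>a. Act a ` G a)" "S (Suc i) = ({}, G a)"
          using concl[of i] prem[of i] by auto
        then obtain b e' where b: "s = RHS" "e = Act b e'" "e' \<in> G b" using e(1) by (cases s) auto
        \<comment> \<open>A right formula on the trace has \<open>W i\<close> in its language, so
          its letter is the one read, and the trace continues in the premiss taken by the
          branch.\<close>
        then have "b = a" using e(2) W(2)[OF True] P by (simp add: sat_simps)
        then show ?thesis using P S b ancestor.anc_P_R by auto
      qed
      then obtain e' where e': "e = Act (l i) e'" "e' \<in> formulas s (S (Suc i))"
        "ancestor (r i) (p i) s e e'" by blast
      have "\<not> active (r i) (p i) s e e'" using True by (simp add: active_def L_def)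
      moreover have "descends (opp s) (Ms (opp s)) False e (W i) e' (W (Suc i))"
        "W (Suc i) \<in> sat (opp s) e'"
        using descends_Act[OF enum_Ms closed_C, of "l i" e' "W i" "opp s"] e eC e' W(2)[OF True]
        by (auto simp: sat_simps split: if_splits)
      ultimately have "Inv (Suc i) e' \<and> Q i e e'" using e' True by (simp add: Inv_def Q_def)
      then show ?thesis by blast
    next
      case False
      note Wi = W(1)[OF False]
      show ?thesis
      proof (cases "principal (r i) = Some (s, e)")
        case True
        have "\<nexists>\<Gamma> f \<Delta>. r i = W_L \<Gamma> f \<Delta>" using canonicalD(6)[OF r] no_conflict[of i] by blast
        \<comment> \<open>A weakened right formula would have \<open>W i\<close> in its language,
          yet its letter differs from the one that \<open>head\<close> prescribes.\<close>
        moreover have "\<nexists>\<Gamma> \<Delta> f. r i = W_R \<Gamma> \<Delta> f"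
        proof
          assume "\<exists>\<Gamma> \<Delta> f. r i = W_R \<Gamma> \<Delta> f"
          then obtain \<Gamma> \<Delta> where "r i = W_R \<Gamma> \<Delta> e" "s = RHS" using True by auto
          moreover from this(1) have "\<exists>a b f g. e = Act b f \<and> Act a g \<in> fst (S i) \<and> a \<noteq> b"
            using canonicalD(7)[OF r _ no_conflict] by blast
          ultimately have "s = RHS" "\<exists>a b f g. e = Act b f \<and> Act a g \<in> fst (S i) \<and> a \<noteq> b" by auto
          then show False using e(2) head by (auto simp: sat_simps)
        qed
        ultimately obtain e' where "e' \<in> formulas s (S (Suc i))" "W i \<in> sat (opp s) e'"
          "active (r i) (p i) s e e'"
          "e' \<in> components e" "descends (opp s) (Ms (opp s)) True e (W i) e' (W i)"
          using trace_step_logical[OF True prem _ e(2)] concl[of i] u(1)[of i] by auto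
        then have "Inv (Suc i) e' \<and> Q i e e'"
          using False Wi by (simp add: Inv_def Q_def ancestor.anc_active)
        then show ?thesis by blast
      next
        case np: False
        then have "e \<in> formulas s (S (Suc i))"
          using side_formula_persists[of "r i" s e "p i"] False prem[of i] concl[of i] e(1)
            by (simp add: L_def)
        moreover from this have "ancestor (r i) (p i) s e e"
          using ancestor.anc_side[of "r i" e s "p i"] False prem[of i] concl[of i] e(1)
            by (simp add: L_def)
        moreover have "\<not> active (r i) (p i) s e e" using np by (simp add: active_def)
        ultimately have "Inv (Suc i) e \<and> Q i e e"
          using False Wi e descends_refl by (simp add: Inv_def Q_def)
        then show ?thesis by blast
      qed
    qed
  qed
  have "\<exists>\<tau>. \<forall>n. Inv n (\<tau> n) \<and> Q n (\<tau> n) (\<tau> (Suc n))"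
    by (rule dependent_nat_choice) (use e0 next_formula in \<open>auto simp: Inv_def\<close>)
  then obtain \<tau> where \<tau>: "\<And>n. Inv n (\<tau> n)" "\<And>n. Q n (\<tau> n) (\<tau> (Suc n))" by blast
  define act where "act i = active (r i) (p i) s (\<tau> i) (\<tau> (Suc i))" for i
  have \<tau>C: "\<tau> i \<in> C" for i using \<tau>(1)[of i] formulas_over[OF u(1)] by (auto simp: Inv_def)
  obtain m where m: "is_fix m" "\<exists>\<^sub>\<infinity>i. \<tau> i = m \<and> act i" "\<And>f. \<exists>\<^sub>\<infinity>i. \<tau> i = f \<and> act i \<Longrightarrow> m \<sqsubseteq> f"
  proof (rule least_principal_exists[where C = C and \<tau> = \<tau> and act = act and is_letter = L])
    show "if act i \<or> L i then \<tau> (Suc i) \<in> components (\<tau> i) else \<tau> (Suc i) = \<tau> i" for i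
      using \<tau>(2)[of i] by (simp add: Q_def act_def)
    show "\<not> act i \<and> \<not> is_fix (\<tau> i)" if "L i" for i
      using \<tau>(2)[of i] that by (simp add: Q_def act_def active_def L_def)
  qed (use finite_C \<tau>C inf in auto)
  have "m \<in> C" using m(2) \<tau>C by (auto simp: INFM_nat_le)
  have "\<not> progress_formula (opp s) m"
  proof
    assume "progress_formula (opp s) m"
    then have "m \<in> set (Ms (opp s))" using \<open>m \<in> C\<close> by (simp add: set_Ms)
    then show False
      by (rule no_progress[OF enum_Ms _ finite_C \<tau>C, where w = W and act = act])
        (use \<tau>(2) m in \<open>auto simp: Q_def act_def\<close>)
  qed
  \<comment> \<open>Every fixed point formula is a progress formula of exactly one side.\<close>
  then have "progress_formula s m" using m(1) by (cases s; cases m) auto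
  moreover have "infinite_trace u p s \<tau>"
    using \<tau> by (auto simp: infinite_trace_def Inv_def Q_def S_def r_def)
  moreover have "inf_principal u p s \<tau> = {f. \<exists>\<^sub>\<infinity>i. \<tau> i = f \<and> act i}"
    by (simp add: inf_principal_def act_def r_def)
  ultimately have "progressing_trace u p s \<tau>"
    unfolding progressing_trace_def using m by blast
  then show "\<exists>s \<tau>. progressing_trace u p s \<tau>" by blast
qed

end

theorem theorem34:
  fixes \<Gamma> \<Delta> :: "('a::finite) exp set"
  assumes "finite \<Gamma>" and "finite \<Delta>"
    and "\<And>e. e \<in> \<Gamma> \<union> \<Delta> \<Longrightarrow> closed_exp e \<and> guarded e"
  shows "(\<exists>P. CRLL_proof P \<and> end_sequent P = (\<Gamma>, \<Delta>)) \<longleftrightarrow>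
    (\<Inter>e\<in>\<Gamma>. lang e) \<subseteq> (\<Union>f\<in>\<Delta>. lang f)"
proof -
  obtain C where C: "finite C" "\<Gamma> \<union> \<Delta> \<subseteq> C" "fl_closed C" "\<And>e. e \<in> C \<Longrightarrow> closed_exp e \<and> guarded e"
    using fl_closure_exists[of "\<Gamma> \<union> \<Delta>"] assms by (metis finite_UnI)
  have "\<exists>Ms. progress_enum s Ms \<and> set Ms = {e \<in> C. progress_formula s e}" for s
    using progress_enum_exists[of C s] C(1,4) by metis
  then obtain Ms where "\<And>s. progress_enum s (Ms s) \<and> set (Ms s) = {e \<in> C. progress_formula s e}"
    by metis
  then interpret guarded_signatures C Ms
    by unfold_locales (use C in auto)
  have over: "over C (\<Gamma>, \<Delta>)" using C(2) by (simp add: over_def)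
  have valid: "(\<Inter>e\<in>\<Gamma>. lang e) \<subseteq> (\<Union>f\<in>\<Delta>. lang f) \<longleftrightarrow> (\<forall>w. \<not> refutes w (\<Gamma>, \<Delta>))"
    by (auto simp: refutes_iff sat_def)
  show ?thesis
  proof
    assume "\<exists>P. CRLL_proof P \<and> end_sequent P = (\<Gamma>, \<Delta>)"
    then show "(\<Inter>e\<in>\<Gamma>. lang e) \<subseteq> (\<Union>f\<in>\<Delta>. lang f)"
      unfolding valid using CRLL_proof_not_refuted over by metis
  next
    assume "(\<Inter>e\<in>\<Gamma>. lang e) \<subseteq> (\<Union>f\<in>\<Delta>. lang f)"
    then have "CRLL_proof (proof_search (\<Gamma>, \<Delta>))"
      unfolding CRLL_proof_def valid
      using over preproof_proof_search regular_proof_search progressing_proof_search by blast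
    then show "\<exists>P. CRLL_proof P \<and> end_sequent P = (\<Gamma>, \<Delta>)"
      using end_sequent_proof_search[OF over] by blast
  qed
qed

end
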